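(* The $3$-colorable subgroup $\mathcal{F}$ of Thompson's group $F$ is isomorphic to the group $F_4=\langle x_1,x_2,\dots \mid x_k^{-1}x_nx_k=x_{n+3}\ \text{for all } 1\le k<n\rangle$.
   Context: Thompson's group $F$ is the group of piecewise linear homeomorphisms of $[0,1]$ with finitely many breakpoints, all dyadic rationals, and all slopes powers of $2$. Each $g\in F$ is represented by a pair $(T_+,T_-)$ of finite rooted planar binary trees with the same number $n\ge 1$ of leaves: the leaves of each tree correspond, from left to right, to the intervals of a standard dyadic partition of $[0,1]$, and $g$ maps the intervals of one partition affinely and in order onto those of the other. A pair representing $g$ is not unique; two pairs represent the same element iff they are related by adding or removing carets at the same leaf in both trees. Given such a pair with $n$ leaves, draw $T_+$ in the upper half plane and $T_-$ upside down in the lower half plane, with the $k$-th leaves of the two trees glued at the point $(k-1/2,0)$, $k=1,\dots,n$, and with the two root edges (joined to one another) included, so as to obtain a cubic planar graph. Its regions are labelled $0,1,\dots,n$ from left to right along the horizontal axis. Let $\Gamma(T_+,T_-)$ be the dual graph, with vertices $(0,0),(1,0),\dots,(n,0)$. Explicitly, two vertices $i<j$ are adjacent in $\Gamma(T_+,T_-)$ iff some vertex of $T_+$ or of $T_-$ (root, internal vertex or leaf) has as its descendant leaves exactly the leaves numbered $i+1,\dots,j$ (a leaf being its own descendant). In particular $k-1$ and $k$ are adjacent for every $k$, and $0$ and $n$ are adjacent. The $3$-colorable subgroup $\mathcal{F}$ is the set of all $g\in F$ such that, for a (equivalently, every) pair of trees $(T_+,T_-)$ representing $g$, the graph $\Gamma(T_+,T_-)$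 is $3$-colorable, i.e. admits a proper vertex coloring with colors $\{a,b,c\}$. *)

theory Defs
  imports "HOL-Analysis.Analysis" "HOL-Algebra.Bij"
begin

section \<open>Thompson's group F\<close>

definition dyadic :: "real set" where
  "dyadic = {of_int m / 2 ^ k | m k. True}"

text \<open>
  The finite set \<open>B\<close> contains the breakpoints and the end points; between consecutive
  elements of \<open>B\<close> the map is affine. Slopes are positive, so the maps preserve orientation.
  Maps are undefined outside the unit interval, as required by \<^const>\<open>BijGroup\<close>.
\<close>

definition thompson_F :: "(real \<Rightarrow> real) set" where
  "thompson_F = {f \<in> extensional {0..1}.
     (\<exists>g. homeomorphism {0..1} {0..1} f g) \<and>
     (\<exists>B. finite B \<and> {0, 1} \<subseteq> B \<and> B \<subseteq> dyadic \<inter> {0..1} \<and>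
        (\<forall>a\<in>B. \<forall>b\<in>B. a < b \<and> B \<inter> {a<..<b} = {} \<longrightarrow>
           (\<exists>(k::int) c. \<forall>x\<in>{a..b}. f x = 2 powi k * x + c)))}"

definition thompson_group :: "(real \<Rightarrow> real) monoid" where
  "thompson_group = (BijGroup {0..1})\<lparr>carrier := thompson_F\<rparr>"


section \<open>Pairs of binary trees\<close>

datatype btree = Leaf | Caret btree btree

fun num_leaves :: "btree \<Rightarrow> nat" where
  "num_leaves Leaf = 1"
| "num_leaves (Caret l r) = num_leaves l + num_leaves r"

text \<open>The intervals of the standard dyadic partition of \<open>[a, b]\<close> given by a tree, from left
  to right, as pairs of end points.\<close>

fun leaf_intervals :: "btree \<Rightarrow> real \<Rightarrow> real \<Rightarrow> (real \<times> real) list" where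
  "leaf_intervals Leaf a b = [(a, b)]"
| "leaf_intervals (Caret l r) a b =
     leaf_intervals l a ((a + b) / 2) @ leaf_intervals r ((a + b) / 2) b"

definition maps_affinely :: "(real \<Rightarrow> real) \<Rightarrow> real \<times> real \<Rightarrow> real \<times> real \<Rightarrow> bool" where
  "maps_affinely g I J \<longleftrightarrow>
     (\<forall>x\<in>{fst I..snd I}. g x = fst J + (snd J - fst J) / (snd I - fst I) * (x - fst I))"

definition represents :: "btree \<Rightarrow> btree \<Rightarrow> (real \<Rightarrow> real) \<Rightarrow> bool" where
  "represents Tp Tm g \<longleftrightarrow>
     num_leaves Tp = num_leaves Tm \<and>
     (\<forall>k < num_leaves Tp. maps_affinely g (leaf_intervals Tp 0 1 ! k) (leaf_intervals Tm 0 1 ! k))"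


section \<open>The dual graph and the 3-colorable subgroup\<close>

text \<open>\<open>(i, j) \<in> leaf_spans t s\<close> iff some vertex of \<open>t\<close> has as its descendant leaves exactly
  those numbered \<open>i + 1, \<dots>, j\<close>, where the leaves of \<open>t\<close> are numbered from \<open>s + 1\<close>.\<close>

fun leaf_spans :: "btree \<Rightarrow> nat \<Rightarrow> (nat \<times> nat) set" where
  "leaf_spans Leaf s = {(s, s + 1)}"
| "leaf_spans (Caret l r) s =
     {(s, s + num_leaves (Caret l r))} \<union> leaf_spans l s \<union> leaf_spans r (s + num_leaves l)"

text \<open>The vertex \<open>(k, 0)\<close> of the dual graph is represented by \<open>k\<close>.\<close>

definition Gamma_verts :: "btree \<Rightarrow> btree \<Rightarrow> nat set" where
  "Gamma_verts Tp Tm = {0..num_leaves Tp}"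

definition Gamma_edges :: "btree \<Rightarrow> btree \<Rightarrow> nat set set" where
  "Gamma_edges Tp Tm = {{i, j} | i j. i < j \<and> (i, j) \<in> leaf_spans Tp 0 \<union> leaf_spans Tm 0}"

datatype color = Color_a | Color_b | Color_c

definition three_colorable :: "'v set \<Rightarrow> 'v set set \<Rightarrow> bool" where
  "three_colorable V E \<longleftrightarrow>
     (\<exists>\<phi> :: 'v \<Rightarrow> color. \<forall>u\<in>V. \<forall>v\<in>V. {u, v} \<in> E \<longrightarrow> \<phi> u \<noteq> \<phi> v)"

definition three_colorable_F :: "(real \<Rightarrow> real) set" where
  "three_colorable_F = {g \<in> thompson_F.
     \<exists>Tp Tm. represents Tp Tm g \<and> three_colorable (Gamma_verts Tp Tm) (Gamma_edges Tp Tm)}"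


section \<open>Groups given by generators and relations\<close>

text \<open>A letter \<open>(x, True)\<close> stands for the generator \<open>x\<close> and \<open>(x, False)\<close> for its formal
  inverse.\<close>

type_synonym 'x word = "('x \<times> bool) list"

text \<open>The least congruence on the words over \<open>X\<close> that makes \<open>(x, True)\<close> and \<open>(x, False)\<close>
  inverse to each other and identifies the two sides of every relation in \<open>R\<close>.\<close>

inductive_set pres_cong :: "'x set \<Rightarrow> ('x word \<times> 'x word) set \<Rightarrow> ('x word \<times> 'x word) set"
  for X R where
  refl: "w \<in> lists (X \<times> UNIV) \<Longrightarrow> (w, w) \<in> pres_cong X R"
| sym: "(u, v) \<in> pres_cong X R \<Longrightarrow> (v, u) \<in> pres_cong X R"
| trans: "(u, v) \<in> pres_cong X R \<Longrightarrow> (v, w) \<in> pres_cong X R \<Longrightarrow> (u, w) \<in> pres_cong X R"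
| append: "(u, u') \<in> pres_cong X R \<Longrightarrow> (v, v') \<in> pres_cong X R \<Longrightarrow> (u @ v, u' @ v') \<in> pres_cong X R"
| cancel: "x \<in> X \<Longrightarrow> ([(x, e), (x, \<not> e)], []) \<in> pres_cong X R"
| rel: "(u, v) \<in> R \<Longrightarrow> u \<in> lists (X \<times> UNIV) \<Longrightarrow> v \<in> lists (X \<times> UNIV) \<Longrightarrow> (u, v) \<in> pres_cong X R"

definition presented_group :: "'x set \<Rightarrow> ('x word \<times> 'x word) set \<Rightarrow> 'x word set monoid" where
  "presented_group X R =
     \<lparr>carrier = lists (X \<times> UNIV) // pres_cong X R,
      mult = \<lambda>A B. \<Union>u\<in>A. \<Union>v\<in>B. pres_cong X R `` {u @ v},
      one = pres_cong X R `` {[]}\<rparr>"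

definition F4_rels :: "(nat word \<times> nat word) set" where
  "F4_rels = {([(k, False), (n, True), (k, True)], [(n + 3, True)]) | k n. 1 \<le> k \<and> k < n}"

definition F4 :: "nat word set monoid" where
  "F4 = presented_group {1..} F4_rels"


lemma pres_cong_words:
  assumes "(u, v) \<in> pres_cong X R"
  shows "u \<in> lists (X \<times> UNIV) \<and> v \<in> lists (X \<times> UNIV)"
  using assms by induction auto

lemma equiv_pres_cong: "equiv (lists (X \<times> UNIV)) (pres_cong X R)"
proof (rule equivI)
  show "pres_cong X R \<subseteq> lists (X \<times> UNIV) \<times> lists (X \<times> UNIV)"
    using pres_cong_words by (metis mem_Sigma_iff subrelI)
  show "refl_on (lists (X \<times> UNIV)) (pres_cong X R)"
    by (rule refl_onI) (rule pres_cong.refl)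
  show "sym (pres_cong X R)" using pres_cong.sym by (rule symI)
  show "trans (pres_cong X R)" using pres_cong.trans by (rule transI)
qed

lemma presented_group_mult:
  assumes "u \<in> lists (X \<times> UNIV)" "v \<in> lists (X \<times> UNIV)"
  shows "pres_cong X R `` {u} \<otimes>\<^bsub>presented_group X R\<^esub> pres_cong X R `` {v} = pres_cong X R `` {u @ v}"
proof -
  have "pres_cong X R `` {u' @ v'} = pres_cong X R `` {u @ v}"
    if "(u, u') \<in> pres_cong X R" "(v, v') \<in> pres_cong X R" for u' v'
    using equiv_class_eq[OF equiv_pres_cong pres_cong.append[OF that]] by simp
  then have "(\<Union>u'\<in>pres_cong X R `` {u}. \<Union>v'\<in>pres_cong X R `` {v}. pres_cong X R `` {u' @ v'}) =
      (\<Union>u'\<in>pres_cong X R `` {u}. \<Union>v'\<in>pres_cong X R `` {v}. pres_cong X R `` {u @ v})"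
    by (metis (no_types, lifting) SUP_cong Image_singleton_iff)
  moreover have "u \<in> pres_cong X R `` {u}" "v \<in> pres_cong X R `` {v}"
    using assms by (simp_all add: pres_cong.refl)
  ultimately show ?thesis
    unfolding presented_group_def by force
qed

lemma pres_cong_inverse:
  assumes "w \<in> lists (X \<times> UNIV)"
  shows "(rev (map (\<lambda>(x, e). (x, \<not> e)) w) @ w, []) \<in> pres_cong X R"
  using assms
proof (induction w)
  case Nil
  then show ?case by (auto intro: pres_cong.refl)
next
  case (Cons p w)
  obtain x e where p: "p = (x, e)" and x: "x \<in> X" using Cons.hyps by auto
  let ?v = "rev (map (\<lambda>(x, e). (x, \<not> e)) w)"
  have v: "?v \<in> lists (X \<times> UNIV)" using Cons.hyps by (auto simp: in_lists_conv_set)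
  have c: "([(x, \<not> e), (x, e)], []) \<in> pres_cong X R"
    using pres_cong.cancel[OF x, of "\<not> e" R] by simp
  have "(?v @ [(x, \<not> e), (x, e)] @ w, ?v @ [] @ w) \<in> pres_cong X R"
    by (intro pres_cong.append pres_cong.refl c v Cons.hyps)
  then have "(?v @ [(x, \<not> e), (x, e)] @ w, []) \<in> pres_cong X R"
    using Cons.IH pres_cong.trans by fastforce
  then show ?case by (simp add: p)
qed

lemma group_presented_group: "group (presented_group X R)"
proof (rule groupI)
  let ?G = "presented_group X R" and ?c = "\<lambda>w. pres_cong X R `` {w}"
  have carr: "\<exists>w\<in>lists (X \<times> UNIV). A = ?c w" if "A \<in> carrier ?G" for A
    using that by (auto simp: presented_group_def quotient_def)
  have carrI: "?c w \<in> carrier ?G" if "w \<in> lists (X \<times> UNIV)" for w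
    using that unfolding presented_group_def by (simp add: quotientI)
  have one: "\<one>\<^bsub>?G\<^esub> = ?c []" by (simp add: presented_group_def)
  show "\<one>\<^bsub>?G\<^esub> \<in> carrier ?G" using carrI[of "[]"] one by simp
  fix A assume A: "A \<in> carrier ?G"
  then obtain u where u: "u \<in> lists (X \<times> UNIV)" "A = ?c u" using carr by blast
  show "\<one>\<^bsub>?G\<^esub> \<otimes>\<^bsub>?G\<^esub> A = A"
    using presented_group_mult[of "[]" X u R] u one by simp
  let ?v = "rev (map (\<lambda>(x, e). (x, \<not> e)) u)"
  have v: "?v \<in> lists (X \<times> UNIV)" using u by (auto simp: in_lists_conv_set)
  have "?c ?v \<otimes>\<^bsub>?G\<^esub> A = \<one>\<^bsub>?G\<^esub>"
    unfolding u(2) one presented_group_mult[OF v u(1)]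
    using equiv_class_eq[OF equiv_pres_cong pres_cong_inverse[OF u(1)]] .
  then show "\<exists>B\<in>carrier ?G. B \<otimes>\<^bsub>?G\<^esub> A = \<one>\<^bsub>?G\<^esub>" using carrI[OF v] by blast
  fix B assume "B \<in> carrier ?G"
  then obtain w where w: "w \<in> lists (X \<times> UNIV)" "B = ?c w" using carr by blast
  show "A \<otimes>\<^bsub>?G\<^esub> B \<in> carrier ?G"
    using carrI[of "u @ w"] u w presented_group_mult[OF u(1) w(1), of R] by auto
  fix C assume "C \<in> carrier ?G"
  then obtain z where z: "z \<in> lists (X \<times> UNIV)" "C = ?c z" using carr by blast
  have uw: "u @ w \<in> lists (X \<times> UNIV)" and wz: "w @ z \<in> lists (X \<times> UNIV)"
    using u w z by auto
  show "A \<otimes>\<^bsub>?G\<^esub> B \<otimes>\<^bsub>?G\<^esub> C = A \<otimes>\<^bsub>?G\<^esub> (B \<otimes>\<^bsub>?G\<^esub> C)"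
    unfolding u(2) w(2) z(2) presented_group_mult[OF u(1) w(1)] presented_group_mult[OF w(1) z(1)]
      presented_group_mult[OF uw z(1)] presented_group_mult[OF u(1) wz] by simp
qed

end

theory Submission
  imports Defs
begin

text \<open>
  The dual graph of one tree is a triangulated polygon, so its 3-coloring is unique up to renaming
  the colors. Orient each edge by whether the color increases cyclically; the two lower edges of a
  triangle are oriented against the upper one. Hence the coloring of the leaf edges records the
  parities of the leaf depths, and the graph of a pair of trees is 3-colorable iff the parities
  agree at corresponding leaves, that is, iff all slopes are powers of 4.

  An infinite comb of 4-carets identifies \<open>[0, 1)\<close> with the half line. There the generator \<open>x\<^sub>k\<close> acts
  as the identity on \<open>[0, k - 1]\<close>, contracts \<open>[k - 1, k + 3]\<close> to \<open>[k - 1, k]\<close> and then translates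
  by \<open>-3\<close>. The action is faithful: a word is a quotient of two positive words, positive words
  can be sorted, and the first letter of a sorted word is seen from the first point it moves.
  It is onto the maps with slopes powers of 4: after a uniform contraction of an initial segment,
  such a map sends each \<open>[i, i + 1]\<close> to a standard 4-adic interval, and expanding the unit
  intervals that are subdivided reduces it to the identity.
\<close>

section \<open>Normal forms in the presented group\<close>

text \<open>On the half line the generators are translates of one map, so all the relations reduce
  to a single computation. The shift by three is the gain in leaves when a leaf is replaced by a
  4-caret, and the comb turns a translation by three into a scaling by four near 1. This is why the
  number 4 governs both the slopes and the relations. The obstacle to surjectivity is that a
  positive word sends every unit interval to a standard 4-adic interval, whereas a general element
  may spread a unit interval over several pieces. Contracting beforehand removes this, and the
  contraction is itself positive. So a general element appears as a quotient of two positive words,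
  the same shape that the normal form gives algebraically. Closure under inverses cannot be read off
  a definition by subdivision of the domain; it comes from inverting words.\<close>

abbreviation F4_cong :: "nat word \<Rightarrow> nat word \<Rightarrow> bool" (infix "\<simeq>\<^sub>4" 50) where
  "u \<simeq>\<^sub>4 v \<equiv> (u, v) \<in> pres_cong {1..} F4_rels"

abbreviation F4_words :: "nat word set" where
  "F4_words \<equiv> lists ({1..} \<times> UNIV)"

definition formal_inverse :: "nat word \<Rightarrow> nat word" where
  "formal_inverse w = rev (map (\<lambda>(x, e). (x, \<not> e)) w)"

definition positive_word :: "nat list \<Rightarrow> nat word" where
  "positive_word = map (\<lambda>k. (k, True))"

lemma formal_inverse_simps [simp]:
  "formal_inverse [] = []"
  "formal_inverse ((k, e) # w) = formal_inverse w @ [(k, \<not> e)]"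
  "formal_inverse (u @ v) = formal_inverse v @ formal_inverse u"
  by (simp_all add: formal_inverse_def)

lemma formal_inverse_involution [simp]: "formal_inverse (formal_inverse w) = w"
  by (simp add: formal_inverse_def rev_map [symmetric] o_def case_prod_unfold)

lemma set_formal_inverse [simp]: "set (formal_inverse w) = (\<lambda>(x, e). (x, \<not> e)) ` set w"
  by (simp add: formal_inverse_def)

lemma formal_inverse_words [simp]:
  "formal_inverse w \<in> lists (X \<times> UNIV) \<longleftrightarrow> w \<in> lists (X \<times> UNIV)"
  by (force simp: in_lists_conv_set)

lemma positive_word_simps [simp]:
  "positive_word [] = []"
  "positive_word (k # p) = (k, True) # positive_word p"
  "positive_word (p @ q) = positive_word p @ positive_word q"
  by (simp_all add: positive_word_def)

lemma set_positive_word [simp]: "set (positive_word p) = (\<lambda>k. (k, True)) ` set p"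
  by (simp add: positive_word_def)

lemma positive_word_words [simp]: "positive_word p \<in> lists (X \<times> UNIV) \<longleftrightarrow> set p \<subseteq> X"
  by (induction p) auto

lemma F4_cong_context:
  assumes "u \<simeq>\<^sub>4 v" "a \<in> F4_words" "b \<in> F4_words"
  shows "a @ u @ b \<simeq>\<^sub>4 a @ v @ b"
  by (intro pres_cong.append pres_cong.refl assms)

lemma F4_cong_trans [trans]: "u \<simeq>\<^sub>4 v \<Longrightarrow> v \<simeq>\<^sub>4 w \<Longrightarrow> u \<simeq>\<^sub>4 w"
  by (rule pres_cong.trans)

lemma F4_cong_left_inverse: "w \<in> F4_words \<Longrightarrow> formal_inverse w @ w \<simeq>\<^sub>4 []"
  unfolding formal_inverse_def by (rule pres_cong_inverse)

lemma F4_cong_right_inverse: "w \<in> F4_words \<Longrightarrow> w @ formal_inverse w \<simeq>\<^sub>4 []"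
  by (metis F4_cong_left_inverse formal_inverse_involution formal_inverse_words)

lemma F4_cong_cancel: "1 \<le> k \<Longrightarrow> [(k, e), (k, \<not> e)] \<simeq>\<^sub>4 []"
  by (rule pres_cong.cancel) simp

lemma F4_cong_conj:
  assumes "1 \<le> k" "k < n"
  shows "[(k, False), (n, True), (k, True)] \<simeq>\<^sub>4 [(n + 3, True)]"
  using assms by (intro pres_cong.rel) (auto simp: F4_rels_def)

section \<open>The conjugation relation as rules for exchanging adjacent letters\<close>

lemma F4_cong_pos_pos:
  assumes "1 \<le> k" "k < n"
  shows "[(n, True), (k, True)] \<simeq>\<^sub>4 [(k, True), (n + 3, True)]"
proof -
  have "[(k, True), (k, \<not> True)] @ [(n, True), (k, True)] \<simeq>\<^sub>4 [] @ [(n, True), (k, True)]"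
    using assms by (intro pres_cong.append F4_cong_cancel pres_cong.refl) auto
  moreover have "[(k, True)] @ [(k, False), (n, True), (k, True)] \<simeq>\<^sub>4 [(k, True)] @ [(n + 3, True)]"
    using assms by (intro pres_cong.append F4_cong_conj pres_cong.refl) auto
  ultimately show ?thesis
    using pres_cong.sym pres_cong.trans by fastforce
qed

lemma F4_cong_neg_pos_less:
  assumes "1 \<le> k" "k < n"
  shows "[(k, False), (n, True)] \<simeq>\<^sub>4 [(n + 3, True), (k, False)]"
proof -
  have "[(k, False), (n, True)] @ [(k, True), (k, \<not> True)] \<simeq>\<^sub>4 [(k, False), (n, True)] @ []"
    using assms by (intro pres_cong.append F4_cong_cancel pres_cong.refl) auto
  moreover have "[(k, False), (n, True), (k, True)] @ [(k, False)] \<simeq>\<^sub>4 [(n + 3, True)] @ [(k, False)]"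
    using assms by (intro pres_cong.append F4_cong_conj pres_cong.refl) auto
  ultimately show ?thesis
    using pres_cong.sym pres_cong.trans by fastforce
qed

lemma F4_cong_neg_pos_greater:
  assumes "1 \<le> k" "k < n"
  shows "[(n, False), (k, True)] \<simeq>\<^sub>4 [(k, True), (n + 3, False)]"
proof -
  have "[(n, False), (k, True)] @ [(n + 3, True), (n + 3, \<not> True)] \<simeq>\<^sub>4 [(n, False), (k, True)] @ []"
    using assms by (intro pres_cong.append F4_cong_cancel pres_cong.refl) auto
  moreover have "[(n, False)] @ [(n, True), (k, True)] @ [(n + 3, False)]
      \<simeq>\<^sub>4 [(n, False)] @ [(k, True), (n + 3, True)] @ [(n + 3, False)]"
    using assms by (intro F4_cong_context F4_cong_pos_pos) auto
  moreover have "[(n, False), (n, \<not> False)] @ [(k, True), (n + 3, False)]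
      \<simeq>\<^sub>4 [] @ [(k, True), (n + 3, False)]"
    using assms by (intro pres_cong.append F4_cong_cancel pres_cong.refl) auto
  ultimately show ?thesis
    by simp (meson pres_cong.sym pres_cong.trans)
qed

text \<open>Passing a positive letter either cancels both letters or raises the larger of the two
  indices by three. The positive word still to be passed gets shorter each time, so induction on it
  with \<open>k\<close> arbitrary suffices; the surviving inverse letter, if any, forms
  \<open>q\<close>.\<close>

lemma neg_letter_past_positive_word:
  assumes "1 \<le> k" "set p \<subseteq> {1..}"
  shows "\<exists>p' q. set p' \<subseteq> {1..} \<and> set q \<subseteq> {1..} \<and>
    (k, False) # positive_word p \<simeq>\<^sub>4 positive_word p' @ formal_inverse (positive_word q)"
  using assms
proof (induction p arbitrary: k)
  case Nil
  have "[(k, False)] \<simeq>\<^sub>4 [(k, False)]"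
    using Nil by (intro pres_cong.refl) auto
  then show ?case
    using Nil by (intro exI [of _ "[]"] exI [of _ "[k]"]) simp
next
  case (Cons n p)
  then have n: "1 \<le> n" and p: "positive_word p \<in> F4_words"
    by auto
  have step: ?case if k': "1 \<le> k'" and n': "1 \<le> n'"
      and swap: "[(k, False), (n, True)] \<simeq>\<^sub>4 [(n', True), (k', False)]" for k' n'
  proof -
    obtain p' q where pq: "set p' \<subseteq> {1..}" "set q \<subseteq> {1..}"
      "(k', False) # positive_word p \<simeq>\<^sub>4 positive_word p' @ formal_inverse (positive_word q)"
      using Cons.IH [OF k'] Cons.prems by auto
    have "[(k, False), (n, True)] @ positive_word p \<simeq>\<^sub>4 [(n', True), (k', False)] @ positive_word p"
      by (intro pres_cong.append swap pres_cong.refl p)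
    also have "[(n', True)] @ (k', False) # positive_word p
        \<simeq>\<^sub>4 [(n', True)] @ positive_word p' @ formal_inverse (positive_word q)"
      using n' by (intro pres_cong.append pq pres_cong.refl) auto
    then have "[(n', True), (k', False)] @ positive_word p
        \<simeq>\<^sub>4 positive_word (n' # p') @ formal_inverse (positive_word q)"
      by simp
    finally show ?thesis
      using pq n' by (intro exI [of _ "n' # p'"] exI [of _ q]) auto
  qed
  consider "k = n" | "k < n" | "n < k" by linarith
  then show ?case
  proof cases
    case 1
    have "[(k, False), (k, \<not> False)] @ positive_word p \<simeq>\<^sub>4 [] @ positive_word p"
      using n 1 by (intro pres_cong.append F4_cong_cancel pres_cong.refl p) auto
    then show ?thesis
      using 1 Cons.prems by (intro exI [of _ p] exI [of _ "[]"]) auto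
  next
    case 2
    with Cons.prems show ?thesis
      by (intro step [of k "n + 3"] F4_cong_neg_pos_less) auto
  next
    case 3
    with n show ?thesis
      by (intro step [of "k + 3" n] F4_cong_neg_pos_greater) auto
  qed
qed

text \<open>Letters are added on the left: a generator joins the numerator; an inverse generator is
  pushed through the numerator, and what survives joins the denominator.\<close>

lemma word_as_fraction:
  assumes "w \<in> F4_words"
  shows "\<exists>p q. set p \<subseteq> {1..} \<and> set q \<subseteq> {1..} \<and>
    w \<simeq>\<^sub>4 positive_word p @ formal_inverse (positive_word q)"
  using assms
proof (induction w)
  case Nil
  then show ?case
    by (intro exI [of _ "[]"]) (auto intro: pres_cong.refl)
next
  case (Cons l w)
  obtain k e where l: "l = (k, e)" "1 \<le> k"
    using Cons.hyps by auto
  obtain p q where pq: "set p \<subseteq> {1..}" "set q \<subseteq> {1..}"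
    "w \<simeq>\<^sub>4 positive_word p @ formal_inverse (positive_word q)"
    using Cons.IH by blast
  have lw: "[(k, e)] @ w \<simeq>\<^sub>4 [(k, e)] @ positive_word p @ formal_inverse (positive_word q)"
    using l by (intro pres_cong.append pq pres_cong.refl) auto
  show ?case
  proof (cases e)
    case True
    then show ?thesis
      using lw pq l by (intro exI [of _ "k # p"] exI [of _ q]) auto
  next
    case False
    obtain p' q' where pq': "set p' \<subseteq> {1..}" "set q' \<subseteq> {1..}"
      "(k, False) # positive_word p \<simeq>\<^sub>4 positive_word p' @ formal_inverse (positive_word q')"
      using neg_letter_past_positive_word l pq by blast
    have "l # w \<simeq>\<^sub>4 ((k, False) # positive_word p) @ formal_inverse (positive_word q)"
      using lw False l by simp
    also have "((k, False) # positive_word p) @ formal_inverse (positive_word q)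
        \<simeq>\<^sub>4 (positive_word p' @ formal_inverse (positive_word q')) @ formal_inverse (positive_word q)"
      using pq by (intro pres_cong.append pq' pres_cong.refl) auto
    \<comment> \<open>The new denominator is \<open>q @ q'\<close> in this order because
      \<open>formal_inverse\<close> reverses its argument.\<close>
    finally have "l # w \<simeq>\<^sub>4 positive_word p' @ formal_inverse (positive_word (q @ q'))"
      by simp
    then show ?thesis
      using pq pq' by (intro exI [of _ p'] exI [of _ "q @ q'"]) auto
  qed
qed

text \<open>The inserted letter grows by three whenever it passes a smaller one, so the result need
  not be a permutation of \<open>n # p\<close>. The clause on lower bounds \<open>m\<close> records
  what the induction needs instead: the letters already in front stay minimal.\<close>

lemma insert_letter_sorted:
  assumes "sorted p" "set p \<subseteq> {1..}" "1 \<le> n"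
  shows "\<exists>p'. sorted p' \<and> set p' \<subseteq> {1..} \<and> (\<forall>m. m \<le> n \<and> (\<forall>x\<in>set p. m \<le> x) \<longrightarrow> (\<forall>x\<in>set p'. m \<le> x)) \<and>
    positive_word (n # p) \<simeq>\<^sub>4 positive_word p'"
  using assms
proof (induction p arbitrary: n)
  case Nil
  then show ?case
    by (intro exI [of _ "[n]"]) (auto intro!: pres_cong.refl)
next
  case (Cons k p)
  show ?case
  proof (cases "n \<le> k")
    case True
    have "positive_word (n # k # p) \<simeq>\<^sub>4 positive_word (n # k # p)"
      by (rule pres_cong.refl) (use Cons.prems in auto)
    then show ?thesis
      using Cons.prems True by (intro exI [of _ "n # k # p"]) auto
  next
    case False
    have "sorted p" "set p \<subseteq> {1..}" "1 \<le> n + 3"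
      using Cons.prems by auto
    from Cons.IH [OF this] obtain p' where p': "sorted p'" "set p' \<subseteq> {1..}"
      "\<forall>m. m \<le> n + 3 \<and> (\<forall>x\<in>set p. m \<le> x) \<longrightarrow> (\<forall>x\<in>set p'. m \<le> x)"
      "positive_word ((n + 3) # p) \<simeq>\<^sub>4 positive_word p'"
      by (elim exE conjE) (rule that)
    have "[(n, True), (k, True)] @ positive_word p \<simeq>\<^sub>4 [(k, True), (n + 3, True)] @ positive_word p"
      using Cons.prems False by (intro pres_cong.append F4_cong_pos_pos pres_cong.refl) auto
    also have "[(k, True)] @ positive_word ((n + 3) # p) \<simeq>\<^sub>4 [(k, True)] @ positive_word p'"
      using Cons.prems by (intro pres_cong.append p' pres_cong.refl) auto
    then have "[(k, True), (n + 3, True)] @ positive_word p \<simeq>\<^sub>4 positive_word (k # p')"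
      by simp
    finally have "positive_word (n # k # p) \<simeq>\<^sub>4 positive_word (k # p')"
      by simp
    moreover have "\<forall>x\<in>set p'. k \<le> x"
      using p'(3) [THEN spec, of k] Cons.prems False by auto
    ultimately show ?thesis
      using p'(1,2) Cons.prems by (intro exI [of _ "k # p'"]) auto
  qed
qed

lemma positive_word_sorted:
  assumes "set p \<subseteq> {1..}"
  shows "\<exists>p'. sorted p' \<and> set p' \<subseteq> {1..} \<and> positive_word p \<simeq>\<^sub>4 positive_word p'"
  using assms
proof (induction p)
  case Nil
  then show ?case
    by (intro exI [of _ "[]"]) (auto intro: pres_cong.refl)
next
  case (Cons n p)
  then obtain p' where p': "sorted p'" "set p' \<subseteq> {1..}" "positive_word p \<simeq>\<^sub>4 positive_word p'"
    by auto
  obtain p'' where p'': "sorted p''" "set p'' \<subseteq> {1..}" "positive_word (n # p') \<simeq>\<^sub>4 positive_word p''"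
    using insert_letter_sorted [OF p'(1,2), of n] Cons.prems by auto
  have "[(n, True)] @ positive_word p \<simeq>\<^sub>4 [(n, True)] @ positive_word p'"
    using Cons.prems by (intro pres_cong.append p' pres_cong.refl) auto
  then show ?case
    using p'' pres_cong.trans by fastforce
qed

section \<open>An action on the half line\<close>

text \<open>The letter \<open>(n, False)\<close> acts by \<open>expand (n - 1)\<close>: expanding, rather than contracting,
  maps represent the inverses because words act from the left.\<close>

definition expand :: "real \<Rightarrow> real \<Rightarrow> real" where
  "expand a t = (if t \<le> a then t else if t \<le> a + 1 then 4 * t - 3 * a else t + 3)"

definition contract :: "real \<Rightarrow> real \<Rightarrow> real" where
  "contract a t = (if t \<le> a then t else if t \<le> a + 4 then (t + 3 * a) / 4 else t - 3)"

lemma contract_expand [simp]: "contract a (expand a t) = t"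
  by (auto simp: contract_def expand_def)

lemma expand_contract [simp]: "expand a (contract a t) = t"
  by (auto simp: contract_def expand_def field_simps)

text \<open>This is the defining relation, with \<open>a = k - 1\<close> and
  \<open>b = n - 1\<close>. Since \<open>a + 1 \<le> b\<close>, \<open>contract b\<close> fixes
  everything up to \<open>a + 1\<close>, where the outer and inner maps cancel. Beyond that point
  \<open>expand a\<close> is translation by 3, which conjugates \<open>contract b\<close> into
  \<open>contract (b + 3)\<close>.\<close>

lemma expand_contract_expand:
  assumes "a + 1 \<le> b"
  shows "expand a (contract b (contract a t)) = contract (b + 3) t"
  using assms by (auto simp: contract_def expand_def field_simps)

lemma expand_nonneg: "0 \<le> t \<Longrightarrow> 0 \<le> expand a t"
  by (auto simp: expand_def)

lemma contract_nonneg: "0 \<le> a \<Longrightarrow> 0 \<le> t \<Longrightarrow> 0 \<le> contract a t"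
  by (auto simp: contract_def)

lemma contract_le: "contract a t \<le> t"
  by (auto simp: contract_def)

lemma contract_less: "a < t \<Longrightarrow> contract a t < t"
  by (auto simp: contract_def)

lemma contract_mono: "s \<le> t \<Longrightarrow> contract a s \<le> contract a t"
  by (auto simp: contract_def)

fun act :: "nat word \<Rightarrow> real \<Rightarrow> real" where
  "act [] t = t"
| "act ((n, e) # w) t = (if e then contract else expand) (real n - 1) (act w t)"

lemma act_append: "act (u @ v) t = act u (act v t)"
  by (induction u) auto

lemma act_nonneg: "w \<in> F4_words \<Longrightarrow> 0 \<le> t \<Longrightarrow> 0 \<le> act w t"
  by (induction w) (auto simp: expand_nonneg contract_nonneg)

lemma act_cong: "u \<simeq>\<^sub>4 v \<Longrightarrow> act u t = act v t"
proof (induction arbitrary: t rule: pres_cong.induct)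
  case (cancel x e)
  then show ?case by (cases e) auto
next
  case (rel u v)
  then obtain k n where kn: "1 \<le> k" "k < n" "u = [(k, False), (n, True), (k, True)]" "v = [(n + 3, True)]"
    by (auto simp: F4_rels_def)
  then have "real k - 1 + 1 \<le> real n - 1"
    by simp
  from expand_contract_expand [OF this] show ?case
    by (simp add: kn algebra_simps)
qed (auto simp: act_append)

lemma act_formal_inverse_cancel [simp]:
  "act (formal_inverse w) (act w t) = t" "act w (act (formal_inverse w) t) = t"
proof -
  show *: "act (formal_inverse w) (act w t) = t" for w t
    by (induction w arbitrary: t) (auto simp: act_append)
  show "act w (act (formal_inverse w) t) = t"
    using * [of "formal_inverse w"] by simp
qed

lemma act_positive_word_le: "act (positive_word p) t \<le> t"
  by (induction p) (auto intro: order_trans [OF contract_le])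

lemma act_positive_word_fixes:
  assumes "\<forall>x\<in>set p. j \<le> x" "t \<le> real j - 1"
  shows "act (positive_word p) t = t"
  using assms by (induction p) (auto simp: contract_def)

lemma act_positive_word_moves:
  "act (positive_word (k # p)) (real k) < real k"
proof -
  have "act (positive_word (k # p)) (real k) \<le> contract (real k - 1) (real k)"
    by (auto intro: contract_mono act_positive_word_le)
  also have "\<dots> < real k"
    by (rule contract_less) simp
  finally show ?thesis .
qed

lemma act_sorted_inj:
  assumes "sorted p" "sorted q" "\<And>t. 0 \<le> t \<Longrightarrow> act (positive_word p) t = act (positive_word q) t"
  shows "p = q"
  using assms
proof (induction p arbitrary: q)
  case Nil
  then show ?case
    using act_positive_word_moves by (cases q) (metis act.simps(1) of_nat_0_le_iff order_less_irrefl positive_word_simps(1))+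
next
  case (Cons k p)
  \<comment> \<open>Letters at least \<open>j\<close> fix everything up to \<open>j - 1\<close>. As
    \<open>i\<close> and \<open>j\<close> are integers, \<open>i < j\<close> puts the point
    \<open>i\<close> in this range, while the word that starts with \<open>i\<close> moves
    it.\<close>
  have less: False
    if "sorted (j # r)" "i < j" "act (positive_word (i # s)) i = act (positive_word (j # r)) i"
    for i j :: nat and r s
    using act_positive_word_moves [of i s] act_positive_word_fixes [of "j # r" j i] that by auto
  show ?case
  proof (cases q)
    case Nil
    then show ?thesis
      using Cons.prems(3) [of k] act_positive_word_moves [of k p] by simp
  next
    case q: (Cons j r)
    have "k = j"
      using less [of j r k p] less [of k p j r] Cons.prems q by (metis linorder_neqE_nat of_nat_0_le_iff)
    moreover have "act (positive_word p) t = act (positive_word r) t" if "0 \<le> t" for t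
      using Cons.prems(3) [OF that] q \<open>k = j\<close> by simp (metis expand_contract)
    then have "p = r"
      using Cons.prems q by (intro Cons.IH) auto
    ultimately show ?thesis
      using q by simp
  qed
qed

lemma act_trivial:
  assumes "w \<in> F4_words" "\<And>t. 0 \<le> t \<Longrightarrow> act w t = t"
  shows "w \<simeq>\<^sub>4 []"
proof -
  obtain p q where pq: "set p \<subseteq> {1..}" "set q \<subseteq> {1..}"
    "w \<simeq>\<^sub>4 positive_word p @ formal_inverse (positive_word q)"
    using word_as_fraction assms by blast
  obtain p' where p': "sorted p'" "set p' \<subseteq> {1..}" "positive_word p \<simeq>\<^sub>4 positive_word p'"
    using positive_word_sorted pq by blast
  obtain q' where q': "sorted q'" "set q' \<subseteq> {1..}" "positive_word q \<simeq>\<^sub>4 positive_word q'"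
    using positive_word_sorted pq by blast
  have "act (positive_word p') t = act (positive_word q') t" if "0 \<le> t" for t
  proof -
    \<comment> \<open>At a point in the image of the denominator the inverse cancels, so only two
      positive words remain to be compared.\<close>
    have "act w (act (positive_word q) t) = act (positive_word p) t"
      by (simp add: act_cong [OF pq(3)] act_append)
    moreover have "act w (act (positive_word q) t) = act (positive_word q) t"
      by (rule assms) (use act_nonneg [of "positive_word q"] pq that in auto)
    ultimately show ?thesis
      by (simp add: act_cong [OF p'(3)] act_cong [OF q'(3)])
  qed
  then have "p' = q'"
    using act_sorted_inj p' q' by blast
  then have "positive_word p \<simeq>\<^sub>4 positive_word q"
    using p' q' pres_cong.sym pres_cong.trans by blast
  then have "positive_word p @ formal_inverse (positive_word q)
      \<simeq>\<^sub>4 positive_word q @ formal_inverse (positive_word q)"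
    using pq by (intro pres_cong.append pres_cong.refl) auto
  also have "positive_word q @ formal_inverse (positive_word q) \<simeq>\<^sub>4 []"
    using pq by (intro F4_cong_right_inverse) auto
  finally show ?thesis
    using pq pres_cong.trans by blast
qed

lemma act_faithful:
  assumes "u \<in> F4_words" "v \<in> F4_words" "\<And>t. 0 \<le> t \<Longrightarrow> act u t = act v t"
  shows "u \<simeq>\<^sub>4 v"
proof -
  have "formal_inverse u @ v \<simeq>\<^sub>4 []"
    using assms by (intro act_trivial) (auto simp: act_append assms(3) [symmetric])
  then have "u @ formal_inverse u @ v \<simeq>\<^sub>4 u @ []"
    using assms by (intro pres_cong.append pres_cong.refl) auto
  moreover have "(u @ formal_inverse u) @ v \<simeq>\<^sub>4 [] @ v"
    using assms by (intro pres_cong.append pres_cong.refl F4_cong_right_inverse) auto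
  ultimately show ?thesis
    using pres_cong.sym pres_cong.trans by fastforce
qed

section \<open>Maps between standard 4-adic intervals\<close>

text \<open>An increasing affine map from the \<open>i\<close>-th 4-adic interval of level
  \<open>M\<close> onto the \<open>j\<close>-th of level \<open>m\<close>, with slope
  \<open>4 ^ M / 4 ^ m\<close>. The indices are unbounded, so the notion serves the half line and
  the unit interval alike. The relative coordinate \<open>s\<close> is preserved, which makes
  composition a substitution.\<close>

definition std_map :: "(real \<Rightarrow> real) \<Rightarrow> nat \<Rightarrow> nat \<Rightarrow> nat \<Rightarrow> nat \<Rightarrow> bool" where
  "std_map f i M j m \<longleftrightarrow> (\<forall>s\<in>{0..1}. f ((real i + s) / 4 ^ M) = (real j + s) / 4 ^ m)"

lemma std_mapD: "std_map f i M j m \<Longrightarrow> 0 \<le> s \<Longrightarrow> s \<le> 1 \<Longrightarrow> f ((real i + s) / 4 ^ M) = (real j + s) / 4 ^ m"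
  by (simp add: std_map_def)

lemma std_mapD_point:
  assumes "std_map f i M j m" "real i \<le> t * 4 ^ M" "t * 4 ^ M \<le> real i + 1"
  shows "f t = (real j + (t * 4 ^ M - real i)) / 4 ^ m"
proof -
  have "f ((real i + (t * 4 ^ M - real i)) / 4 ^ M) = (real j + (t * 4 ^ M - real i)) / 4 ^ m"
    using assms by (intro std_mapD) auto
  then show ?thesis by simp
qed

lemma std_map_subdivide:
  assumes "std_map f i M j m" "r < 4 ^ K"
  shows "std_map f (i * 4 ^ K + r) (M + K) (j * 4 ^ K + r) (m + K)"
  unfolding std_map_def
proof
  fix s :: real assume s: "s \<in> {0..1}"
  have "real r + 1 \<le> 4 ^ K"
    using assms(2) by (metis Suc_leI of_nat_Suc of_nat_le_iff of_nat_numeral of_nat_power add.commute)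
  then have "0 \<le> (real r + s) / 4 ^ K" "(real r + s) / 4 ^ K \<le> 1"
    using s by auto
  from std_mapD [OF assms(1) this]
  show "f ((real (i * 4 ^ K + r) + s) / 4 ^ (M + K)) = (real (j * 4 ^ K + r) + s) / 4 ^ (m + K)"
    by (simp add: power_add field_simps)
qed

lemma std_map_refine:
  assumes "std_map f (i div 4 ^ K) M j m"
  shows "\<exists>j'. std_map f i (M + K) j' (m + K)"
  using std_map_subdivide [OF assms, of "i mod 4 ^ K" K] unfolding div_mult_mod_eq by auto

lemma std_map_compose:
  assumes "std_map g i M j m" "std_map f j m k n"
  shows "std_map (\<lambda>t. f (g t)) i M k n"
  using assms by (auto simp: std_map_def)

lemma div_power_bounds:
  fixes i m :: nat
  shows "real (i div 4 ^ m) \<le> real i / 4 ^ m" "(real i + 1) / 4 ^ m \<le> real (i div 4 ^ m) + 1"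
proof -
  have "(i div 4 ^ m) * 4 ^ m \<le> i"
    by simp
  then have "real ((i div 4 ^ m) * 4 ^ m) \<le> real i"
    by (simp only: of_nat_le_iff)
  then show "real (i div 4 ^ m) \<le> real i / 4 ^ m"
    by (simp add: field_simps)
  have "i + 1 \<le> (i div 4 ^ m + 1) * 4 ^ m"
    by (metis Suc_eq_plus1 Suc_leI dividend_less_div_times mult.commute add.commute mult_Suc_right
        zero_less_numeral zero_less_power)
  then have "real (i + 1) \<le> real ((i div 4 ^ m + 1) * 4 ^ m)"
    by (simp only: of_nat_le_iff)
  then show "(real i + 1) / 4 ^ m \<le> real (i div 4 ^ m) + 1"
    by (simp add: field_simps)
qed

lemma div_power_bounds_between:
  fixes i m :: nat
  assumes "0 \<le> s" "s \<le> 1"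
  shows "real (i div 4 ^ m) \<le> (real i + s) / 4 ^ m" "(real i + s) / 4 ^ m \<le> real (i div 4 ^ m) + 1"
proof -
  have "real i / 4 ^ m \<le> (real i + s) / 4 ^ m" "(real i + s) / 4 ^ m \<le> (real i + 1) / 4 ^ m"
    using assms by (auto intro: divide_right_mono)
  then show "real (i div 4 ^ m) \<le> (real i + s) / 4 ^ m" "(real i + s) / 4 ^ m \<le> real (i div 4 ^ m) + 1"
    using div_power_bounds [of i m] by linarith+
qed

lemma expand_eqs:
  "t \<le> a \<Longrightarrow> expand a t = t"
  "a \<le> t \<Longrightarrow> t \<le> a + 1 \<Longrightarrow> expand a t = 4 * t - 3 * a"
  "a + 1 \<le> t \<Longrightarrow> expand a t = t + 3"
  by (auto simp: expand_def)

lemma contract_eqs: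
  "t \<le> a \<Longrightarrow> contract a t = t"
  "a \<le> t \<Longrightarrow> t \<le> a + 4 \<Longrightarrow> contract a t = (t + 3 * a) / 4"
  "a + 4 \<le> t \<Longrightarrow> contract a t = t - 3"
  by (auto simp: contract_def)

text \<open>The number \<open>i div 4 ^ m\<close> is the left end of the unit interval that contains
  the piece. Stretching by four lowers the level by one; this fails only for the whole interval
  \<open>[k, k + 1]\<close>, whose image consists of four unit intervals. Elsewhere the map is a
  translation by an integer.\<close>

lemma std_map_expand:
  assumes "i div 4 ^ m = k \<Longrightarrow> 0 < m"
  shows "\<exists>j. std_map (expand (real k)) i m j (if i div 4 ^ m = k then m - 1 else m)"
proof -
  note b = div_power_bounds_between [of _ i m]
  consider "i div 4 ^ m < k" | "i div 4 ^ m = k" | "k < i div 4 ^ m"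
    by linarith
  then show ?thesis
  proof cases
    case 1
    then have "real (i div 4 ^ m) + 1 \<le> real k"
      by linarith
    then have "std_map (expand (real k)) i m i m"
      unfolding std_map_def using b by (intro ballI expand_eqs) fastforce
    with 1 show ?thesis by auto
  next
    case 2
    then obtain m' where m: "m = Suc m'"
      using assms gr0_implies_Suc by blast
    have "k * 4 ^ m \<le> i"
      unfolding 2 [symmetric] by simp
    then have le: "3 * k * 4 ^ m' \<le> i"
      by (simp add: m)
    have "std_map (expand (real k)) i m (i - 3 * k * 4 ^ m') m'"
      unfolding std_map_def
    proof
      fix s :: real assume "s \<in> {0..1}"
      then have "real k \<le> (real i + s) / 4 ^ m" "(real i + s) / 4 ^ m \<le> real k + 1"
        using b [of s] 2 by auto
      then have "expand (real k) ((real i + s) / 4 ^ m) = 4 * ((real i + s) / 4 ^ m) - 3 * real k"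
        by (rule expand_eqs)
      also have "\<dots> = (real (i - 3 * k * 4 ^ m') + s) / 4 ^ m'"
        using le by (simp add: of_nat_diff m field_simps)
      finally show "expand (real k) ((real i + s) / 4 ^ m) = (real (i - 3 * k * 4 ^ m') + s) / 4 ^ m'" .
    qed
    with 2 m show ?thesis by auto
  next
    case 3
    have "std_map (expand (real k)) i m (i + 3 * 4 ^ m) m"
      unfolding std_map_def
    proof
      fix s :: real assume "s \<in> {0..1}"
      then have "real k + 1 \<le> (real i + s) / 4 ^ m"
        using b [of s] 3 by auto
      then have "expand (real k) ((real i + s) / 4 ^ m) = (real i + s) / 4 ^ m + 3"
        by (rule expand_eqs)
      then show "expand (real k) ((real i + s) / 4 ^ m) = (real (i + 3 * 4 ^ m) + s) / 4 ^ m"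
        by (simp add: field_simps)
    qed
    with 3 show ?thesis by auto
  qed
qed

text \<open>Contraction has no exceptional case: a standard interval lies between consecutive
  integers, hence in one affine piece of \<open>contract\<close>, and division by four just raises
  the level.\<close>

lemma std_map_contract: "\<exists>j m'. std_map (contract (real k)) i m j m'"
proof -
  note b = div_power_bounds_between [of _ i m]
  consider "i div 4 ^ m < k" | "k \<le> i div 4 ^ m" "i div 4 ^ m < k + 4" | "k + 4 \<le> i div 4 ^ m"
    by linarith
  then show ?thesis
  proof cases
    case 1
    then have "real (i div 4 ^ m) + 1 \<le> real k"
      by linarith
    then have "std_map (contract (real k)) i m i m"
      unfolding std_map_def using b by (intro ballI contract_eqs) fastforce
    then show ?thesis by auto
  next
    case 2
    have "std_map (contract (real k)) i m (i + 3 * k * 4 ^ m) (Suc m)"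
      unfolding std_map_def
    proof
      fix s :: real assume "s \<in> {0..1}"
      then have "real k \<le> (real i + s) / 4 ^ m" "(real i + s) / 4 ^ m \<le> real k + 4"
        using b [of s] 2 by auto
      then have "contract (real k) ((real i + s) / 4 ^ m) = ((real i + s) / 4 ^ m + 3 * real k) / 4"
        by (rule contract_eqs)
      then show "contract (real k) ((real i + s) / 4 ^ m) = (real (i + 3 * k * 4 ^ m) + s) / 4 ^ Suc m"
        by (simp add: field_simps)
    qed
    then show ?thesis by auto
  next
    case 3
    then have "3 * 4 ^ m \<le> i div 4 ^ m * 4 ^ m"
      by (intro mult_right_mono) auto
    then have le: "3 * 4 ^ m \<le> i"
      by (meson div_times_less_eq_dividend order_trans)
    have "std_map (contract (real k)) i m (i - 3 * 4 ^ m) m"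
      unfolding std_map_def
    proof
      fix s :: real assume "s \<in> {0..1}"
      then have "real k + 4 \<le> (real i + s) / 4 ^ m"
        using b [of s] 3 by auto
      then have "contract (real k) ((real i + s) / 4 ^ m) = (real i + s) / 4 ^ m - 3"
        by (rule contract_eqs)
      then show "contract (real k) ((real i + s) / 4 ^ m) = (real (i - 3 * 4 ^ m) + s) / 4 ^ m"
        using le by (simp add: of_nat_diff field_simps)
    qed
    then show ?thesis by auto
  qed
qed

text \<open>Induction on the total depth of the image intervals: composing with \<open>expand k\<close> lowers the
  depth of those inside \<open>[k, k + 1]\<close> and keeps that of all others.\<close>

lemma std_pieces_imp_positive_word:
  assumes "e 0 = 0" "inj_on e {0..}" "\<And>i. std_map e i 0 (j i) (m i)" "\<And>i. N \<le> i \<Longrightarrow> m i = 0"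
  shows "\<exists>p. set p \<subseteq> {1..} \<and> (\<forall>t\<ge>0. e t = act (positive_word p) t)"
  using assms
proof (induction "\<Sum>i<N. m i" arbitrary: e j m rule: less_induct)
  case less
  have e: "e (real i + s) = (real (j i) + s) / 4 ^ m i" if "0 \<le> s" "s \<le> 1" for i s
    using std_mapD [OF less.prems(3) that, of i] by simp
  show ?case
  proof (cases "\<forall>i<N. m i = 0")
    case True
    then have m: "m i = 0" for i
      using less.prems(4) [of i] by (meson not_le)
    \<comment> \<open>Consecutive pieces share an end point, so their translated images must be
      consecutive too, starting from \<open>e 0 = 0\<close>.\<close>
    have j: "j i = i" for i
    proof (induction i)
      case 0
      show ?case using e [of 0 0] less.prems(1) m by simp
    next
      case (Suc i)
      then show ?case using e [of 1 i] e [of 0 "Suc i"] m by (simp add: add.commute)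
    qed
    have "e t = t" if "0 \<le> t" for t
    proof -
      have "real (nat \<lfloor>t\<rfloor>) \<le> t" "t - real (nat \<lfloor>t\<rfloor>) \<le> 1"
        using that by linarith+
      then show ?thesis
        using e [of "t - real (nat \<lfloor>t\<rfloor>)" "nat \<lfloor>t\<rfloor>"] m j by simp
    qed
    then show ?thesis
      by (intro exI [of _ "[]"]) auto
  next
    case False
    then obtain i where i: "i < N" "0 < m i"
      by auto
    define k where "k = j i div 4 ^ m i"
    define m' where "m' i' = (if j i' div 4 ^ m i' = k then m i' - 1 else m i')" for i'
    define e' where "e' t = expand (real k) (e t)" for t
    have pos: "0 < m i'" if k': "j i' div 4 ^ m i' = k" for i'
    proof (rule ccontr)
      assume "\<not> 0 < m i'"
      then have z: "m i' = 0" "j i' = k" using k' by auto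
      \<comment> \<open>If piece \<open>i'\<close> filled all of \<open>[k, k + 1]\<close>, it would
        take at \<open>s\<close> the value that \<open>e\<close> has at the midpoint of piece
        \<open>i\<close>. The midpoint is chosen because neighbouring pieces share end points, where
        injectivity would not force \<open>i' = i\<close>.\<close>
      define s where "s = (real (j i) + 1 / 2) / 4 ^ m i - real k"
      have s: "0 \<le> s" "s \<le> 1"
        using div_power_bounds_between [of "1 / 2" "j i" "m i"] unfolding s_def k_def by linarith+
      have "e (real i' + s) = real k + s"
        using e [OF s, of i'] unfolding z by simp
      also have "\<dots> = e (real i + 1 / 2)"
        using e [of "1 / 2" i] unfolding s_def by simp
      finally have "e (real i' + s) = e (real i + 1 / 2)" .
      then have "real i' + s = real i + 1 / 2"
        by (rule inj_onD [OF less.prems(2)]) (use s in auto)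
      then have "i' = i"
        using s by linarith
      then show False
        using i z by simp
    qed
    have "\<exists>j''. std_map (expand (real k)) (j i') (m i') j'' (m' i')" for i'
      unfolding m'_def by (rule std_map_expand) (rule pos)
    then obtain j' where j': "\<And>i'. std_map (expand (real k)) (j i') (m i') (j' i') (m' i')"
      by metis
    have "(\<Sum>i<N. m' i) < (\<Sum>i<N. m i)"
      using i by (intro sum_strict_mono_ex1) (auto simp: m'_def k_def intro!: bexI [of _ i])
    moreover have "e' 0 = 0"
      using less.prems(1) by (simp add: e'_def expand_def)
    moreover have "inj_on e' {0..}"
      using less.prems(2) unfolding inj_on_def e'_def by (metis contract_expand)
    moreover have "std_map e' i' 0 (j' i') (m' i')" for i'
      unfolding e'_def by (rule std_map_compose [OF less.prems(3) j'])
    moreover have "m' i' = 0" if "N \<le> i'" for i'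
      using less.prems(4) [OF that] by (simp add: m'_def)
    ultimately obtain p where p: "set p \<subseteq> {1..}" "\<forall>t\<ge>0. e' t = act (positive_word p) t"
      using less.hyps by blast
    \<comment> \<open>Letters are numbered from 1, so \<open>Suc k\<close> acts by
      \<open>contract k\<close> and undoes the expansion.\<close>
    have "e t = act (positive_word (Suc k # p)) t" if "0 \<le> t" for t
    proof -
      have "e t = contract (real k) (e' t)"
        by (simp add: e'_def)
      then show ?thesis
        using p that by simp
    qed
    then show ?thesis
      using p by (intro exI [of _ "Suc k # p"]) auto
  qed
qed

section \<open>Maps whose slopes are powers of 4\<close>

text \<open>These are the elements of Thompson's group with all slopes powers of 4; a uniform 4-adic
  subdivision of the domain, fine enough, always has standard 4-adic images.\<close>

definition slope4_F :: "(real \<Rightarrow> real) set" where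
  "slope4_F = {g \<in> extensional {0..1}. g 0 = 0 \<and> g 1 = 1 \<and>
     (\<exists>M. \<forall>i<4 ^ M. \<exists>j m. std_map g i M j m)}"

lemma unit_interval_cell:
  assumes "0 \<le> x" "x \<le> 1" "0 < n"
  shows "\<exists>i<n. real i \<le> x * real n \<and> x * real n \<le> real i + 1"
proof (cases "x = 1")
  case True
  then show ?thesis
    using assms by (intro exI [of _ "n - 1"]) (auto simp: of_nat_diff)
next
  case False
  then have "x * real n < real n" "0 \<le> x * real n"
    using assms by auto
  then show ?thesis
    by (intro exI [of _ "nat \<lfloor>x * real n\<rfloor>"]) linarith
qed

text \<open>The scale \<open>c\<close> is a parameter because the cells have length
  \<open>1 / 4 ^ M\<close> on the unit interval and length 1 on the half line.\<close>

lemma piecewise_strict_mono: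
  fixes g :: "real \<Rightarrow> real"
  assumes "0 < c" "\<And>i. i < n \<Longrightarrow> strict_mono_on {real i / c..(real i + 1) / c} g"
  shows "strict_mono_on {0..real n / c} g"
  using assms(2)
proof (induction n)
  case 0
  then show ?case by (auto simp: strict_mono_on_def)
next
  case (Suc n)
  then have IH: "strict_mono_on {0..real n / c} g" and S: "strict_mono_on {real n / c..(real n + 1) / c} g"
    by auto
  show ?case
  proof (rule strict_mono_onI)
    fix x y :: real
    assume xy: "x \<in> {0..real (Suc n) / c}" "y \<in> {0..real (Suc n) / c}" "x < y"
    consider "y \<le> real n / c" | "real n / c \<le> x" | "x < real n / c" "real n / c < y"
      by linarith
    then show "g x < g y"
    proof cases
      case 1
      then show ?thesis
        using xy by (intro strict_mono_onD [OF IH]) auto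
    next
      case 2
      then show ?thesis
        using xy by (intro strict_mono_onD [OF S]) (auto simp: add.commute)
    next
      case 3
      then have "g x < g (real n / c)"
        using xy assms(1) by (intro strict_mono_onD [OF IH]) auto
      also have "\<dots> < g y"
        using 3 xy assms(1) by (intro strict_mono_onD [OF S]) (auto simp: add.commute divide_right_mono)
      finally show ?thesis .
    qed
  qed
qed

lemma std_map_affine:
  assumes "std_map g i M j m" "t \<in> {real i / 4 ^ M..(real i + 1) / 4 ^ M}"
  shows "g t = (real j + (t * 4 ^ M - real i)) / 4 ^ m"
  using assms by (intro std_mapD_point) (auto simp: field_simps)

lemma std_map_strict_mono_on:
  assumes "std_map g i M j m"
  shows "strict_mono_on {real i / 4 ^ M..(real i + 1) / 4 ^ M} g"
proof (rule strict_mono_onI)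
  fix x y :: real
  assume "x \<in> {real i / 4 ^ M..(real i + 1) / 4 ^ M}" "y \<in> {real i / 4 ^ M..(real i + 1) / 4 ^ M}" "x < y"
  then show "g x < g y"
    using assms by (simp add: std_map_affine [OF assms] divide_strict_right_mono)
qed

lemma std_map_continuous_on:
  assumes "std_map g i M j m"
  shows "continuous_on {real i / 4 ^ M..(real i + 1) / 4 ^ M} g"
proof -
  have "continuous_on {real i / 4 ^ M..(real i + 1) / 4 ^ M} (\<lambda>t. (real j + (t * 4 ^ M - real i)) / 4 ^ m)"
    by (intro continuous_intros) auto
  then show ?thesis
    by (rule continuous_on_eq) (simp add: std_map_affine [OF assms])
qed

lemma slope4_F_strict_mono:
  assumes "g \<in> slope4_F"
  shows "strict_mono_on {0..1} g"
proof -
  obtain M where M: "\<forall>i<4 ^ M. \<exists>j m. std_map g i M j m"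
    using assms by (auto simp: slope4_F_def)
  have "strict_mono_on {0..real (4 ^ M) / 4 ^ M} g"
  proof (rule piecewise_strict_mono)
    fix i :: nat assume "i < 4 ^ M"
    then show "strict_mono_on {real i / 4 ^ M..(real i + 1) / 4 ^ M} g"
      using M std_map_strict_mono_on by meson
  qed simp
  then show ?thesis by simp
qed

lemma slope4_F_continuous:
  assumes "g \<in> slope4_F"
  shows "continuous_on {0..1} g"
proof -
  obtain M where M: "\<forall>i<4 ^ M. \<exists>j m. std_map g i M j m"
    using assms by (auto simp: slope4_F_def)
  have "continuous_on (\<Union>i\<in>{..<4 ^ M}. {real i / 4 ^ M..(real i + 1) / 4 ^ M}) g"
  proof (rule continuous_on_closed_Union)
    fix i :: nat assume "i \<in> {..<4 ^ M}"
    then show "continuous_on {real i / 4 ^ M..(real i + 1) / 4 ^ M} g"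
      using M std_map_continuous_on by (meson lessThan_iff)
  qed auto
  moreover have "{0..1} \<subseteq> (\<Union>i\<in>{..<4 ^ M}. {real i / 4 ^ M..(real i + 1) / 4 ^ M})"
  proof
    fix x :: real assume "x \<in> {0..1}"
    then obtain i where "i < 4 ^ M" "real i \<le> x * 4 ^ M" "x * 4 ^ M \<le> real i + 1"
      using unit_interval_cell [of x "4 ^ M"] by auto
    then show "x \<in> (\<Union>i\<in>{..<4 ^ M}. {real i / 4 ^ M..(real i + 1) / 4 ^ M})"
      by (intro UN_I [of i]) (auto simp: field_simps)
  qed
  ultimately show ?thesis
    by (rule continuous_on_subset)
qed

lemma slope4_F_image:
  assumes "g \<in> slope4_F"
  shows "g ` {0..1} = {0..1}"
proof
  have g: "g 0 = 0" "g 1 = 1"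
    using assms by (auto simp: slope4_F_def)
  have mono: "g x \<le> g y" if "x \<in> {0..1}" "y \<in> {0..1}" "x \<le> y" for x y
    using strict_mono_on_leD [OF slope4_F_strict_mono [OF assms] that] .
  show "g ` {0..1} \<subseteq> {0..1}"
    using mono [of 0] mono [of _ 1] g by force
  show "{0..1} \<subseteq> g ` {0..1}"
  proof
    fix y :: real assume "y \<in> {0..1}"
    then show "y \<in> g ` {0..1}"
      using IVT' [of g 0 y 1] slope4_F_continuous [OF assms] g by fastforce
  qed
qed

lemma slope4_F_bij:
  assumes "g \<in> slope4_F"
  shows "g \<in> Bij {0..1}"
proof -
  have "bij_betw g {0..1} {0..1}"
    unfolding bij_betw_def
    using slope4_F_image [OF assms] strict_mono_on_imp_inj_on [OF slope4_F_strict_mono [OF assms]] by simp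
  then show ?thesis
    using assms by (simp add: Bij_def slope4_F_def)
qed

lemma std_map_slope:
  assumes "std_map g i M j m" "x \<in> {real i / 4 ^ M..(real i + 1) / 4 ^ M}"
  shows "g x = 2 powi (int (2 * M) - int (2 * m)) * x + (real j - real i) / 4 ^ m"
proof -
  have "(2::real) powi (int (2 * M) - int (2 * m)) = 4 ^ M / 4 ^ m"
    unfolding power_int_diff [OF disjI1 [OF zero_neq_numeral [symmetric]]] power_int_of_nat by (simp add: power_mult)
  then show ?thesis
    using std_map_affine [OF assms] by (simp add: field_simps)
qed

lemma slope4_F_subset_thompson_F: "slope4_F \<subseteq> thompson_F"
proof
  fix g assume g: "g \<in> slope4_F"
  obtain M where M: "\<forall>i<4 ^ M. \<exists>j m. std_map g i M j m"
    using g by (auto simp: slope4_F_def)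
  have ext: "g \<in> extensional {0..1}"
    using g by (simp add: slope4_F_def)
  obtain g' where hom: "homeomorphism {0..1} {0..1} g g'"
    using homeomorphism_compact [OF compact_Icc slope4_F_continuous [OF g] slope4_F_image [OF g]]
      strict_mono_on_imp_inj_on [OF slope4_F_strict_mono [OF g]] by blast
  \<comment> \<open>All grid points count as breakpoints, even where the slope does not change;
    neighbours in \<open>B\<close> are then neighbours in the grid.\<close>
  define B where "B = (\<lambda>i. real i / 4 ^ M) ` {..4 ^ M}"
  have "finite B"
    by (simp add: B_def)
  have "0 \<in> B"
    unfolding B_def by (rule image_eqI [of _ _ 0]) auto
  moreover have "1 \<in> B"
    unfolding B_def by (rule image_eqI [of _ _ "4 ^ M"]) auto
  ultimately have "{0, 1} \<subseteq> B"
    by simp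
  have "B \<subseteq> dyadic \<inter> {0..1}"
  proof -
    have "real i / 4 ^ M = of_int (int i) / 2 ^ (2 * M)" for i
      by (simp add: power_mult)
    then have "real i / 4 ^ M \<in> dyadic" for i
      unfolding dyadic_def by blast
    moreover have "real i / 4 ^ M \<le> 1" if "i \<le> 4 ^ M" for i
      using that by (simp add: divide_le_eq)
    ultimately show ?thesis
      by (auto simp: B_def)
  qed
  have affine: "\<exists>(k::int) c. \<forall>x\<in>{a..b}. g x = 2 powi k * x + c"
    if ab: "a \<in> B" "b \<in> B" "a < b" "B \<inter> {a<..<b} = {}" for a b
  proof -
    obtain i i' where i: "i \<le> 4 ^ M" "a = real i / 4 ^ M" "i' \<le> 4 ^ M" "b = real i' / 4 ^ M"
      using ab by (auto simp: B_def)
    have "i < i'"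
      using ab i by (simp add: divide_less_cancel)
    have "i' = i + 1"
    proof (rule ccontr)
      assume "i' \<noteq> i + 1"
      with \<open>i < i'\<close> have "i + 1 < i'" by simp
      then have "real (i + 1) / 4 ^ M \<in> B" "a < real (i + 1) / 4 ^ M" "real (i + 1) / 4 ^ M < b"
        using i unfolding B_def by (auto simp: divide_strict_right_mono simp del: of_nat_add of_nat_Suc)
      then show False
        using ab(4) by auto
    qed
    moreover from this obtain j m where "std_map g i M j m"
      using M i \<open>i < i'\<close> by (meson order_less_le_trans)
    ultimately show ?thesis
      using std_map_slope [of g i M j m] i by (metis of_nat_1 of_nat_add)
  qed
  show "g \<in> thompson_F"
    unfolding thompson_F_def
  proof (intro CollectI conjI exI [of _ B] exI [of _ g'] ballI impI)
    fix a b assume "a \<in> B" "b \<in> B" "a < b \<and> B \<inter> {a<..<b} = {}"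
    then show "\<exists>(k::int) c. \<forall>x\<in>{a..b}. g x = 2 powi k * x + c"
      using affine by simp
  qed fact+
qed

section \<open>Trees and standard dyadic partitions\<close>

fun chain :: "real \<Rightarrow> (real \<times> real) list \<Rightarrow> real \<Rightarrow> bool" where
  "chain a [] b \<longleftrightarrow> a = b"
| "chain a (I # xs) b \<longleftrightarrow> fst I = a \<and> chain (snd I) xs b"

definition dyadic_subinterval :: "real \<Rightarrow> real \<Rightarrow> nat \<Rightarrow> nat \<Rightarrow> real \<times> real" where
  "dyadic_subinterval a b j n = (a + (b - a) * real j / 2 ^ n, a + (b - a) * (real j + 1) / 2 ^ n)"

definition dyadic_subintervals :: "real \<Rightarrow> real \<Rightarrow> (real \<times> real) set" where
  "dyadic_subintervals a b = {dyadic_subinterval a b j n | j n. j < 2 ^ n}"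

lemma chain_append: "chain a (xs @ ys) b \<longleftrightarrow> (\<exists>c. chain a xs c \<and> chain c ys b)"
  by (induction xs arbitrary: a) auto

lemma chain_le:
  assumes "chain a xs b" "\<forall>I\<in>set xs. fst I < snd I"
  shows "a \<le> b" "a = b \<Longrightarrow> xs = []"
proof -
  have "a \<le> b \<and> (xs \<noteq> [] \<longrightarrow> a < b)"
    using assms by (induction xs arbitrary: a) fastforce+
  then show "a \<le> b" "a = b \<Longrightarrow> xs = []" by auto
qed

lemma chain_bounds:
  assumes "chain a xs b" "\<forall>I\<in>set xs. fst I < snd I" "I \<in> set xs"
  shows "a \<le> fst I" "snd I \<le> b"
proof -
  obtain ys zs where xs: "xs = ys @ I # zs"
    using assms(3) split_list by metis
  then have "chain a ys (fst I)" "chain (snd I) zs b"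
    using assms(1) by (auto simp: chain_append)
  then show "a \<le> fst I" "snd I \<le> b"
    using assms(2) xs by (auto dest: chain_le)
qed

lemma chain_split:
  assumes "chain a xs b" "\<forall>I\<in>set xs. snd I \<le> c \<or> c \<le> fst I" "a \<le> c" "c \<le> b"
  shows "\<exists>ys zs. xs = ys @ zs \<and> chain a ys c \<and> chain c zs b"
  using assms
proof (induction xs arbitrary: a)
  case Nil
  then show ?case by auto
next
  case (Cons I xs)
  show ?case
  proof (cases "snd I \<le> c")
    case True
    then obtain ys zs where "xs = ys @ zs" "chain (snd I) ys c" "chain c zs b"
      using Cons.IH [of "snd I"] Cons.prems by auto
    then show ?thesis
      using Cons.prems by (intro exI [of _ "I # ys"] exI [of _ zs]) auto
  next
    case False
    then have "a = c"
      using Cons.prems by auto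
    then show ?thesis
      using Cons.prems by (intro exI [of _ "[]"] exI [of _ "I # xs"]) auto
  qed
qed

lemma dyadic_subintervals_bounds:
  assumes "a < b" "I \<in> dyadic_subintervals a b"
  shows "a \<le> fst I" "fst I < snd I" "snd I \<le> b"
proof -
  obtain j n where j: "j < 2 ^ n" "I = dyadic_subinterval a b j n"
    using assms by (auto simp: dyadic_subintervals_def)
  then have "real (j + 1) \<le> real (2 ^ n)"
    by (subst of_nat_le_iff) simp
  then have "(real j + 1) / 2 ^ n \<le> 1"
    by simp
  from mult_left_mono [OF this, of "b - a"] have "(b - a) * ((real j + 1) / 2 ^ n) \<le> b - a"
    using assms by simp
  then show "snd I \<le> b"
    by (simp add: j dyadic_subinterval_def)
  show "a \<le> fst I" "fst I < snd I"
    using assms by (simp_all add: j dyadic_subinterval_def divide_strict_right_mono)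
qed

lemma dyadic_subinterval_left:
  "dyadic_subinterval a ((a + b) / 2) j n = dyadic_subinterval a b j (Suc n)"
  by (simp add: dyadic_subinterval_def field_simps)

lemma dyadic_subinterval_right:
  "dyadic_subinterval ((a + b) / 2) b j n = dyadic_subinterval a b (j + 2 ^ n) (Suc n)"
  by (simp add: dyadic_subinterval_def field_simps)

text \<open>The leading binary digit of \<open>j\<close> decides the half; only the whole interval
  straddles the midpoint.\<close>

lemma dyadic_subintervals_halves:
  assumes "I \<in> dyadic_subintervals a b" "I \<noteq> (a, b)"
  shows "I \<in> dyadic_subintervals a ((a + b) / 2) \<or> I \<in> dyadic_subintervals ((a + b) / 2) b"
proof -
  obtain j n where j: "j < 2 ^ n" "I = dyadic_subinterval a b j n"
    using assms by (auto simp: dyadic_subintervals_def)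
  then obtain n' where n: "n = Suc n'"
    using assms(2) by (cases n) (auto simp: dyadic_subinterval_def)
  show ?thesis
  proof (cases "j < 2 ^ n'")
    case True
    moreover have "I = dyadic_subinterval a ((a + b) / 2) j n'"
      using j n by (simp add: dyadic_subinterval_left)
    ultimately show ?thesis
      unfolding dyadic_subintervals_def by blast
  next
    case False
    then have "I = dyadic_subinterval ((a + b) / 2) b (j - 2 ^ n') n'" "j - 2 ^ n' < 2 ^ n'"
      using j n by (auto simp: dyadic_subinterval_right)
    then show ?thesis
      unfolding dyadic_subintervals_def by blast
  qed
qed

text \<open>If the whole interval occurs in the list, it is the whole list and the tree is a leaf.
  Otherwise no member straddles the midpoint, so the list splits there into two nonempty, hence
  shorter, partitions that give the subtrees.\<close>

lemma dyadic_partition_tree: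
  assumes "a < b" "chain a xs b" "set xs \<subseteq> dyadic_subintervals a b"
  shows "\<exists>t. leaf_intervals t a b = xs"
  using assms
proof (induction xs arbitrary: a b rule: length_induct)
  case (1 xs)
  have lt: "\<forall>I\<in>set xs. fst I < snd I"
    using 1(2,4) dyadic_subintervals_bounds by blast
  show ?case
  proof (cases "(a, b) \<in> set xs")
    case True
    then obtain ys zs where xs: "xs = ys @ (a, b) # zs"
      using split_list by metis
    then have "chain a ys a" "chain b zs b"
      using 1(3) by (auto simp: chain_append)
    then have "ys = []" "zs = []"
      using chain_le(2) lt xs by auto
    then show ?thesis
      using xs by (intro exI [of _ Leaf]) simp
  next
    case False
    define c where "c = (a + b) / 2"
    have c: "a < c" "c < b"
      using 1(2) by (auto simp: c_def)
    have halves: "I \<in> dyadic_subintervals a c \<or> I \<in> dyadic_subintervals c b" if "I \<in> set xs" for I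
      using dyadic_subintervals_halves 1(4) False that unfolding c_def by blast
    then have "\<forall>I\<in>set xs. snd I \<le> c \<or> c \<le> fst I"
      using dyadic_subintervals_bounds c by blast
    then obtain ys zs where xs: "xs = ys @ zs" and yz: "chain a ys c" "chain c zs b"
      using chain_split [OF 1(3)] c by (meson less_imp_le)
    have "set ys \<subseteq> dyadic_subintervals a c"
    proof
      fix I assume I: "I \<in> set ys"
      have "fst I < snd I" "snd I \<le> c"
        using chain_bounds(2) [OF yz(1) _ I] lt xs I by auto
      then show "I \<in> dyadic_subintervals a c"
        using halves [of I] dyadic_subintervals_bounds(1) [OF c(2), of I] I xs by auto
    qed
    moreover have "set zs \<subseteq> dyadic_subintervals c b"
    proof
      fix I assume I: "I \<in> set zs"
      have "fst I < snd I" "c \<le> fst I"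
        using chain_bounds(1) [OF yz(2) _ I] lt xs I by auto
      then show "I \<in> dyadic_subintervals c b"
        using halves [of I] dyadic_subintervals_bounds(3) [OF c(1), of I] I xs by auto
    qed
    moreover have "ys \<noteq> []" "zs \<noteq> []"
      using yz c by auto
    then have "length ys < length xs" "length zs < length xs"
      using xs by auto
    ultimately obtain l r where "leaf_intervals l a c = ys" "leaf_intervals r c b = zs"
      using 1(1) c yz by meson
    then show ?thesis
      using xs c_def by (intro exI [of _ "Caret l r"]) simp
  qed
qed

lemma chain_map_upt: "chain (p 0) (map (\<lambda>i. (p i, p (Suc i))) [0..<n]) (p n)"
  by (induction n) (auto simp: chain_append)

section \<open>Leaf depths and slopes\<close>

fun leaf_depths :: "btree \<Rightarrow> nat list" where
  "leaf_depths Leaf = [0]"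
| "leaf_depths (Caret l r) = map Suc (leaf_depths l @ leaf_depths r)"

lemma length_leaf_depths [simp]: "length (leaf_depths t) = num_leaves t"
  by (induction t) auto

lemma length_leaf_intervals [simp]: "length (leaf_intervals t a b) = num_leaves t"
  by (induction t arbitrary: a b) auto

lemma num_leaves_pos [simp]: "0 < num_leaves t"
  by (induction t) auto

lemma leaf_intervals_nth:
  assumes "k < num_leaves t"
  shows "\<exists>j. leaf_intervals t a b ! k = dyadic_subinterval a b j (leaf_depths t ! k)"
  using assms
proof (induction t arbitrary: a b k)
  case Leaf
  then show ?case
    by (intro exI [of _ 0]) (simp add: dyadic_subinterval_def)
next
  case (Caret l r)
  show ?case
  proof (cases "k < num_leaves l")
    case True
    then show ?thesis
      using Caret.IH(1) [OF True, of a "(a + b) / 2"]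
      by (auto simp: nth_append dyadic_subinterval_left)
  next
    case False
    then have "k - num_leaves l < num_leaves r"
      using Caret.prems by auto
    then show ?thesis
      using False Caret.prems Caret.IH(2) [of "k - num_leaves l" "(a + b) / 2" b]
      by (auto simp: nth_append dyadic_subinterval_right)
  qed
qed

lemma leaf_intervals_cover:
  assumes "a \<le> y" "y < b"
  shows "\<exists>k<num_leaves t. fst (leaf_intervals t a b ! k) \<le> y \<and> y < snd (leaf_intervals t a b ! k)"
proof -
  have "\<exists>I\<in>set (leaf_intervals t a b). fst I \<le> y \<and> y < snd I"
    using assms
  proof (induction t arbitrary: a b)
    case (Caret l r)
    show ?case
    proof (cases "y < (a + b) / 2")
      case True
      with Caret.IH(1) [of a "(a + b) / 2"] Caret.prems show ?thesis by auto
    next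
      case False
      with Caret.IH(2) [of "(a + b) / 2" b] Caret.prems show ?thesis by auto
    qed
  qed auto
  then show ?thesis
    by (metis in_set_conv_nth length_leaf_intervals)
qed

lemma leaf_intervals_ends:
  "fst (leaf_intervals t a b ! 0) = a" "snd (leaf_intervals t a b ! (num_leaves t - 1)) = b"
proof -
  have ne: "leaf_intervals t a b \<noteq> []" for t a b
    by (metis length_0_conv length_leaf_intervals less_irrefl num_leaves_pos)
  have "fst (hd (leaf_intervals t a b)) = a \<and> snd (last (leaf_intervals t a b)) = b"
    by (induction t arbitrary: a b) (auto simp: ne)
  then show "fst (leaf_intervals t a b ! 0) = a" "snd (leaf_intervals t a b ! (num_leaves t - 1)) = b"
    by (simp_all add: hd_conv_nth last_conv_nth ne)
qed

text \<open>Between leaves of depths \<open>d\<close> and \<open>d'\<close> the slope is 2 to the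
  power \<open>d - d'\<close>. Cutting the domain down to binary depth \<open>2 * M\<close> takes
  \<open>e = 2 * M - d\<close> halvings and puts the image at depth \<open>e + d'\<close>. This is
  even because \<open>d + d'\<close> is, and an even binary depth is a 4-adic level, even when
  \<open>d\<close> and \<open>d'\<close> are both odd.\<close>

lemma represents_std_map:
  assumes "represents Tp Tm g" "\<And>k. k < num_leaves Tp \<Longrightarrow> even (leaf_depths Tp ! k + leaf_depths Tm ! k)"
  shows "\<exists>M. \<forall>i<4 ^ M. \<exists>j m. std_map g i M j m"
\<comment> \<open>The sum bounds every leaf depth, so binary depth \<open>2 * M\<close> refines
  every leaf interval of \<open>Tp\<close>.\<close>
proof (rule exI [of _ "sum_list (leaf_depths Tp)"], intro allI impI)
  define M where "M = sum_list (leaf_depths Tp)"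
  fix i :: nat assume i: "i < 4 ^ sum_list (leaf_depths Tp)"
  then have "real i < real (4 ^ M)"
    unfolding M_def by (subst of_nat_less_iff)
  then have "real i / 4 ^ M < 1"
    by simp
  then obtain k where k: "k < num_leaves Tp"
    and ik: "fst (leaf_intervals Tp 0 1 ! k) \<le> real i / 4 ^ M" "real i / 4 ^ M < snd (leaf_intervals Tp 0 1 ! k)"
    using leaf_intervals_cover [of 0 "real i / 4 ^ M" 1 Tp] by auto
  define d d' where "d = leaf_depths Tp ! k" and "d' = leaf_depths Tm ! k"
  obtain j where j: "leaf_intervals Tp 0 1 ! k = dyadic_subinterval 0 1 j d"
    using leaf_intervals_nth [OF k] d_def by blast
  obtain j' where j': "leaf_intervals Tm 0 1 ! k = dyadic_subinterval 0 1 j' d'"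
    using leaf_intervals_nth [of k Tm 0 1] k assms(1) d'_def unfolding represents_def by auto
  have "d \<le> M"
    unfolding d_def M_def using k by (intro member_le_sum_list) auto
  define e where "e = 2 * M - d"
  have Me: "(4::real) ^ M = 2 ^ d * 2 ^ e"
    using \<open>d \<le> M\<close> by (simp add: e_def power_add [symmetric] power_mult)
  have "even (d + d')"
    using assms(2) [OF k] by (simp add: d_def d'_def)
  then have "even (e + d')"
    using \<open>d \<le> M\<close> unfolding e_def by (auto simp: even_diff_nat)
  then obtain m where m: "e + d' = 2 * m"
    by (elim evenE)
  have me: "(4::real) ^ m = 2 ^ e * 2 ^ d'"
    unfolding power_add [symmetric] m by (simp add: power_mult)
  have "real j * 2 ^ e \<le> real i" "real i < (real j + 1) * 2 ^ e"
    using ik by (simp_all add: j dyadic_subinterval_def Me field_simps)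
  then have "real (j * 2 ^ e) \<le> real i" "real i < real ((j + 1) * 2 ^ e)"
    by (simp_all add: algebra_simps)
  then have ji: "j * 2 ^ e \<le> i" "i + 1 \<le> (j + 1) * 2 ^ e"
    unfolding of_nat_le_iff of_nat_less_iff by linarith+
  have "real (i + 1) \<le> real ((j + 1) * 2 ^ e)"
    using ji(2) by (subst of_nat_le_iff)
  then have i1: "real i + 1 \<le> (real j + 1) * 2 ^ e"
    by (simp add: algebra_simps)
  have "std_map g i M (j' * 2 ^ e + (i - j * 2 ^ e)) m"
    unfolding std_map_def
  proof
    fix s :: real assume s: "s \<in> {0..1}"
    define x where "x = (real i + s) / 4 ^ M"
    have b: "real j \<le> (real i + s) / 2 ^ e" "(real i + s) / 2 ^ e \<le> real j + 1"
      using s i1 \<open>real j * 2 ^ e \<le> real i\<close> by (auto simp: pos_le_divide_eq pos_divide_le_eq)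
    have "x = (real i + s) / 2 ^ e / 2 ^ d"
      by (simp add: x_def Me)
    then have "real j / 2 ^ d \<le> x" "x \<le> (real j + 1) / 2 ^ d"
      using b by (simp_all only: divide_right_mono zero_le_power zero_le_numeral)
    then have "g x = real j' / 2 ^ d' + (1 / 2 ^ d') / (1 / 2 ^ d) * (x - real j / 2 ^ d)"
      using assms(1) k unfolding represents_def maps_affinely_def
      by (simp add: j j' dyadic_subinterval_def add_divide_distrib)
    also have "\<dots> = (real j' * 2 ^ e + (real i - real j * 2 ^ e) + s) / 4 ^ m"
      by (simp add: x_def Me me field_simps)
    also have "\<dots> = (real (j' * 2 ^ e + (i - j * 2 ^ e)) + s) / 4 ^ m"
      using ji by (simp add: of_nat_diff)
    finally show "g ((real i + s) / 4 ^ M) = (real (j' * 2 ^ e + (i - j * 2 ^ e)) + s) / 4 ^ m"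
      by (simp add: x_def)
  qed
  then show "\<exists>j m. std_map g i (sum_list (leaf_depths Tp)) j m"
    unfolding M_def by blast
qed

lemma represents_ends:
  assumes "represents Tp Tm g"
  shows "g 0 = 0" "g 1 = 1"
proof -
  have len: "num_leaves Tm = num_leaves Tp"
    using assms by (simp add: represents_def)
  have aff: "g (fst I) = fst J" "g (snd I) = snd J"
    if k: "k < num_leaves Tp" and I: "I = leaf_intervals Tp 0 1 ! k"
      and J: "J = leaf_intervals Tm 0 1 ! k" for k I J
  proof -
    obtain j where "I = dyadic_subinterval 0 1 j (leaf_depths Tp ! k)"
      unfolding I using leaf_intervals_nth [OF k] by blast
    then have "fst I < snd I"
      by (simp add: dyadic_subinterval_def divide_strict_right_mono)
    moreover have "maps_affinely g I J"
      using assms k I J by (simp add: represents_def)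
    ultimately show "g (fst I) = fst J" "g (snd I) = snd J"
      by (auto simp: maps_affinely_def)
  qed
  show "g 0 = 0"
    using aff(1) [of 0] leaf_intervals_ends(1) [of _ 0 1] by simp
  show "g 1 = 1"
    using aff(2) [of "num_leaves Tp - 1"] leaf_intervals_ends(2) [of Tp 0 1] leaf_intervals_ends(2) [of Tm 0 1] len
    by simp
qed

section \<open>Colorings and depths\<close>

fun next_color :: "color \<Rightarrow> color" where
  "next_color Color_a = Color_b"
| "next_color Color_b = Color_c"
| "next_color Color_c = Color_a"

lemma next_color_neq: "next_color x \<noteq> x" "next_color (next_color x) \<noteq> x"
  by (cases x; simp)+

lemma next_color_cycle: "next_color (next_color (next_color x)) = x"
  by (cases x) simp_all

text \<open>Read the colors modulo 3, so that every properly colored edge is a step of 1 or -1. The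
  steps of the two lower edges add up to that of the upper edge; their sum is nonzero, so they are
  equal, and twice a step is its negative.\<close>

lemma next_color_triangle:
  assumes "x \<noteq> y" "y \<noteq> z" "x \<noteq> z"
  shows "y = next_color x \<longleftrightarrow> z \<noteq> next_color x" "z = next_color y \<longleftrightarrow> z \<noteq> next_color x"
  using assms by (cases x; cases y; cases z; simp)+

lemma leaf_spans_root: "(s, s + num_leaves t) \<in> leaf_spans t s"
  by (cases t) auto

lemma leaf_spans_bounds: "(i, j) \<in> leaf_spans t s \<Longrightarrow> s \<le> i \<and> i < j \<and> j \<le> s + num_leaves t"
  by (induction t arbitrary: s) (fastforce simp: trans_le_add1)+

text \<open>The two lower edges of a triangle are oriented against its upper edge, so the orientation
  of the edge below a leaf is determined by the parity of its depth.\<close>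

lemma coloring_leaf_orientation:
  assumes "\<And>i j. (i, j) \<in> leaf_spans t s \<Longrightarrow> c i \<noteq> c j" "k < num_leaves t"
  shows "c (s + k + 1) = next_color (c (s + k)) \<longleftrightarrow>
    (even (leaf_depths t ! k) \<longleftrightarrow> c (s + num_leaves t) = next_color (c s))"
  using assms
proof (induction t arbitrary: s k)
  case Leaf
  then show ?case by simp
next
  case (Caret l r)
  let ?m = "s + num_leaves l" and ?e = "s + num_leaves (Caret l r)"
  have e: "?e = ?m + num_leaves r" by simp
  have "c s \<noteq> c ?m" "c ?m \<noteq> c ?e" "c s \<noteq> c ?e"
    using Caret.prems(1) leaf_spans_root [of s l] leaf_spans_root [of ?m r] leaf_spans_root [of s "Caret l r"]
    unfolding e by auto
  note tri = next_color_triangle [OF this]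
  show ?case
  proof (cases "k < num_leaves l")
    case True
    have "c (s + k + 1) = next_color (c (s + k)) \<longleftrightarrow>
        (even (leaf_depths l ! k) \<longleftrightarrow> c ?m = next_color (c s))"
      using Caret.prems(1) True by (intro Caret.IH(1)) auto
    then show ?thesis
      using True tri by (auto simp: nth_append)
  next
    case False
    then have "k - num_leaves l < num_leaves r"
      using Caret.prems(2) by auto
    then have "c (?m + (k - num_leaves l) + 1) = next_color (c (?m + (k - num_leaves l))) \<longleftrightarrow>
        (even (leaf_depths r ! (k - num_leaves l)) \<longleftrightarrow> c (?m + num_leaves r) = next_color (c ?m))"
      using Caret.prems(1) by (intro Caret.IH(2)) auto
    then show ?thesis
      using False tri \<open>k - num_leaves l < num_leaves r\<close> unfolding e by (auto simp: nth_append)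
  qed
qed

text \<open>The converse of the previous lemma: orientations prescribed at the leaves by depth
  parity fit together to a proper coloring. Here \<open>p\<close> is the orientation of the root
  edge, and applying \<open>next_color\<close> twice is the step -1. Depths in the subtrees are
  smaller by one, so both subtrees get orientation \<open>\<not> p\<close>, and two such steps make
  one step of orientation \<open>p\<close>.\<close>

lemma orientation_coloring:
  assumes "\<And>k. k < num_leaves t \<Longrightarrow>
    c (s + k + 1) = (if even (leaf_depths t ! k) = p then next_color (c (s + k)) else next_color (next_color (c (s + k))))"
  shows "c (s + num_leaves t) = (if p then next_color (c s) else next_color (next_color (c s)))"
    "(i, j) \<in> leaf_spans t s \<Longrightarrow> c i \<noteq> c j"
proof -
  have "c (s + num_leaves t) = (if p then next_color (c s) else next_color (next_color (c s))) \<and>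
      (\<forall>(i, j) \<in> leaf_spans t s. c i \<noteq> c j)"
    using assms
  proof (induction t arbitrary: s p)
    case Leaf
    then show ?case
      using next_color_neq [of "c s"] by (auto simp: eq_commute [of "c s"])
  next
    case (Caret l r)
    let ?m = "s + num_leaves l"
    have l: "c ?m = (if \<not> p then next_color (c s) else next_color (next_color (c s))) \<and>
        (\<forall>(i, j) \<in> leaf_spans l s. c i \<noteq> c j)"
    proof (rule Caret.IH(1))
      fix k assume "k < num_leaves l"
      then show "c (s + k + 1) = (if even (leaf_depths l ! k) = (\<not> p)
          then next_color (c (s + k)) else next_color (next_color (c (s + k))))"
        using Caret.prems [of k] by (auto simp: nth_append)
    qed
    have r: "c (?m + num_leaves r) = (if \<not> p then next_color (c ?m) else next_color (next_color (c ?m))) \<and>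
        (\<forall>(i, j) \<in> leaf_spans r ?m. c i \<noteq> c j)"
    proof (rule Caret.IH(2))
      fix k assume "k < num_leaves r"
      then show "c (?m + k + 1) = (if even (leaf_depths r ! k) = (\<not> p)
          then next_color (c (?m + k)) else next_color (next_color (c (?m + k))))"
        using Caret.prems [of "num_leaves l + k"] by (auto simp: nth_append add.assoc)
    qed
    have "c (s + num_leaves (Caret l r)) = (if p then next_color (c s) else next_color (next_color (c s)))"
      using l r by (simp add: add.assoc next_color_cycle)
    then show ?case
      using l r next_color_neq [of "c s"] by (auto simp: eq_commute [of "c s"] split: if_splits)
  qed
  then show "c (s + num_leaves t) = (if p then next_color (c s) else next_color (next_color (c s)))"
    "(i, j) \<in> leaf_spans t s \<Longrightarrow> c i \<noteq> c j"
    by auto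
qed

text \<open>The two trees share the root edge and all leaf edges. A common coloring gives each of
  these one orientation, which forces equal parities; conversely, equal parities make a single
  sequence of colors proper for both trees.\<close>

lemma three_colorable_Gamma_iff:
  assumes "num_leaves Tp = num_leaves Tm"
  shows "three_colorable (Gamma_verts Tp Tm) (Gamma_edges Tp Tm) \<longleftrightarrow>
    (\<forall>k<num_leaves Tp. even (leaf_depths Tp ! k + leaf_depths Tm ! k))"
proof
  assume "three_colorable (Gamma_verts Tp Tm) (Gamma_edges Tp Tm)"
  then obtain c :: "nat \<Rightarrow> color" where c: "\<And>u v. u \<in> Gamma_verts Tp Tm \<Longrightarrow> v \<in> Gamma_verts Tp Tm \<Longrightarrow>
      {u, v} \<in> Gamma_edges Tp Tm \<Longrightarrow> c u \<noteq> c v"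
    unfolding three_colorable_def by blast
  have proper: "c i \<noteq> c j" if "(i, j) \<in> leaf_spans Tp 0 \<union> leaf_spans Tm 0" for i j
  proof (rule c)
    have "i < j" "j \<le> num_leaves Tp"
      using that leaf_spans_bounds [of i j Tp 0] leaf_spans_bounds [of i j Tm 0] assms by auto
    then show "i \<in> Gamma_verts Tp Tm" "j \<in> Gamma_verts Tp Tm" "{i, j} \<in> Gamma_edges Tp Tm"
      using that unfolding Gamma_verts_def Gamma_edges_def by auto
  qed
  show "\<forall>k<num_leaves Tp. even (leaf_depths Tp ! k + leaf_depths Tm ! k)"
  proof (intro allI impI)
    fix k assume "k < num_leaves Tp"
    then show "even (leaf_depths Tp ! k + leaf_depths Tm ! k)"
      using coloring_leaf_orientation [of Tp 0 c k] coloring_leaf_orientation [of Tm 0 c k] proper assms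
      by auto
  qed
next
  assume even: "\<forall>k<num_leaves Tp. even (leaf_depths Tp ! k + leaf_depths Tm ! k)"
  \<comment> \<open>The colors advance along the axis by 1 or -1 according to the leaf depth; this
    is the orientation \<open>p = True\<close> of the root edge.\<close>
  define c where "c = rec_nat Color_a (\<lambda>k x. if even (leaf_depths Tp ! k) then next_color x
    else next_color (next_color x))"
  have Suc: "c (Suc k) = (if even (leaf_depths Tp ! k) then next_color (c k)
    else next_color (next_color (c k)))" for k
    by (simp add: c_def)
  have Tp: "c i \<noteq> c j" if "(i, j) \<in> leaf_spans Tp 0" for i j
    using orientation_coloring(2) [of Tp c 0 True i j] that by (simp add: Suc)
  have Tm: "c i \<noteq> c j" if "(i, j) \<in> leaf_spans Tm 0" for i j
    using orientation_coloring(2) [of Tm c 0 True i j] that even assms by (simp add: Suc)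
  show "three_colorable (Gamma_verts Tp Tm) (Gamma_edges Tp Tm)"
    unfolding three_colorable_def
  proof (intro exI ballI impI)
    fix u v assume "{u, v} \<in> Gamma_edges Tp Tm"
    then show "c u \<noteq> c v"
      unfolding Gamma_edges_def using Tp Tm by (fastforce simp: doubleton_eq_iff)
  qed
qed

section \<open>From slopes powers of 4 back to pairs of trees\<close>

lemma slope4_F_represents:
  assumes "g \<in> slope4_F"
  shows "\<exists>Tp Tm. represents Tp Tm g \<and> (\<forall>k<num_leaves Tp. even (leaf_depths Tp ! k + leaf_depths Tm ! k))"
proof -
  obtain M j m where M: "\<And>i. i < 4 ^ M \<Longrightarrow> std_map g i M (j i) (m i)"
    using assms unfolding slope4_F_def by (auto, metis)
  have g: "g 0 = 0" "g 1 = 1"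
    using assms by (auto simp: slope4_F_def)
  define p where "p i = real i / 4 ^ M" for i
  have p_ends: "p 0 = 0" "p (4 ^ M) = 1"
    by (simp_all add: p_def)
  let ?part = "\<lambda>q. map (\<lambda>i. (q i, q (Suc i))) [0..<4 ^ M]"
  have p_int: "(p i, p (Suc i)) = dyadic_subinterval 0 1 i (2 * M)" for i
    by (simp add: p_def dyadic_subinterval_def power_mult add.commute)
  have g_int: "(g (p i), g (p (Suc i))) = dyadic_subinterval 0 1 (j i) (2 * m i)" if "i < 4 ^ M" for i
    using std_mapD [OF M [OF that], of 0] std_mapD [OF M [OF that], of 1]
    by (simp add: p_def dyadic_subinterval_def power_mult add.commute)
  have p01: "p i \<in> {0..1}" if "i \<le> 4 ^ M" for i
  proof -
    have "real i \<le> real (4 ^ M)"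
      using that by (subst of_nat_le_iff)
    then show ?thesis by (simp add: p_def)
  qed
  have "set (?part p) \<subseteq> dyadic_subintervals 0 1"
  proof -
    have "dyadic_subinterval 0 1 i (2 * M) \<in> dyadic_subintervals 0 1" if "i < 4 ^ M" for i
      unfolding dyadic_subintervals_def
      using that by (intro CollectI exI [of _ i] exI [of _ "2 * M"]) (simp add: power_mult)
    then show ?thesis by (auto simp: p_int)
  qed
  moreover have "chain 0 (?part p) 1"
    using chain_map_upt [of p "4 ^ M"] unfolding p_ends .
  ultimately obtain Tp where Tp: "leaf_intervals Tp 0 1 = ?part p"
    using dyadic_partition_tree [OF zero_less_one] by blast
  have "set (?part (\<lambda>i. g (p i))) \<subseteq> dyadic_subintervals 0 1"
  proof -
    have "dyadic_subinterval 0 1 (j i) (2 * m i) \<in> dyadic_subintervals 0 1" if "i < 4 ^ M" for i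
    proof -
      have "g (p (Suc i)) \<le> 1"
        using slope4_F_image [OF assms] p01 [of "Suc i"] that by (metis Suc_leI atLeastAtMost_iff image_eqI)
      then have "(real (j i) + 1) / 4 ^ m i \<le> 1"
        using g_int [OF that] by (simp add: dyadic_subinterval_def power_mult)
      then have "real (j i + 1) \<le> real (4 ^ m i)"
        by (simp add: divide_le_eq)
      then have "j i < 2 ^ (2 * m i)"
        unfolding of_nat_le_iff by (simp add: power_mult)
      then show ?thesis
        unfolding dyadic_subintervals_def by blast
    qed
    then show ?thesis by (auto simp: g_int)
  qed
  moreover have "chain 0 (?part (\<lambda>i. g (p i))) 1"
    using chain_map_upt [of "\<lambda>i. g (p i)" "4 ^ M"] unfolding p_ends g .
  ultimately obtain Tm where Tm: "leaf_intervals Tm 0 1 = ?part (\<lambda>i. g (p i))"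
    using dyadic_partition_tree [OF zero_less_one] by blast
  have num: "num_leaves Tp = 4 ^ M" "num_leaves Tm = 4 ^ M"
    using arg_cong [OF Tp, of length] arg_cong [OF Tm, of length] by simp_all
  \<comment> \<open>The trees are known only through their intervals; the length of an interval
    gives back the depth of its leaf.\<close>
  have depth: "leaf_depths t ! k = 2 * n"
    if k: "k < num_leaves t" and eq: "leaf_intervals t 0 1 ! k = dyadic_subinterval 0 1 i (2 * n)" for t k i n
  proof -
    obtain i' where "leaf_intervals t 0 1 ! k = dyadic_subinterval 0 1 i' (leaf_depths t ! k)"
      using leaf_intervals_nth k by blast
    then have "dyadic_subinterval 0 1 i' (leaf_depths t ! k) = dyadic_subinterval 0 1 i (2 * n)"
      using eq by simp
    then have "(2::real) ^ (leaf_depths t ! k) = 2 ^ (2 * n)"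
      unfolding dyadic_subinterval_def by (auto simp: add_divide_distrib)
    then show ?thesis
      by (simp only: power_inject_exp)
  qed
  have "represents Tp Tm g"
    unfolding represents_def
  proof (intro conjI allI impI)
    show "num_leaves Tp = num_leaves Tm"
      unfolding num ..
  next
    fix k assume k: "k < num_leaves Tp"
    then have k': "k < 4 ^ M" unfolding num .
    have "g x = g (p k) + (g (p (Suc k)) - g (p k)) / (p (Suc k) - p k) * (x - p k)"
      if "x \<in> {p k..p (Suc k)}" for x
    proof -
      have "g x = (real (j k) + (x * 4 ^ M - real k)) / 4 ^ m k"
        using that by (intro std_map_affine [OF M [OF k']]) (auto simp: p_def add.commute)
      moreover have gp: "g (p k) = real (j k) / 4 ^ m k" "g (p (Suc k)) = (real (j k) + 1) / 4 ^ m k"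
        using g_int [OF k'] by (auto simp: dyadic_subinterval_def power_mult)
      moreover have "g (p (Suc k)) - g (p k) = 1 / 4 ^ m k"
        unfolding gp by (simp add: add_divide_distrib)
      moreover have "p (Suc k) - p k = 1 / 4 ^ M" "x - p k = (x * 4 ^ M - real k) / 4 ^ M"
        by (simp_all add: p_def field_simps)
      ultimately show ?thesis
        by (simp add: add_divide_distrib)
    qed
    moreover have nth: "?part q ! k = (q k, q (Suc k))" for q :: "nat \<Rightarrow> real"
      using k' by simp
    ultimately show "maps_affinely g (leaf_intervals Tp 0 1 ! k) (leaf_intervals Tm 0 1 ! k)"
      unfolding Tp Tm nth [of p] nth [of "\<lambda>i. g (p i)"] maps_affinely_def fst_conv snd_conv by blast
  qed
  moreover have "even (leaf_depths Tp ! k + leaf_depths Tm ! k)" if k: "k < num_leaves Tp" for k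
  proof -
    have k': "k < 4 ^ M"
      using k unfolding num .
    have "leaf_intervals Tp 0 1 ! k = dyadic_subinterval 0 1 k (2 * M)"
      "leaf_intervals Tm 0 1 ! k = dyadic_subinterval 0 1 (j k) (2 * m k)"
      unfolding Tp Tm using k' p_int [of k] g_int [OF k'] by simp_all
    then have "leaf_depths Tp ! k = 2 * M" "leaf_depths Tm ! k = 2 * m k"
      using depth [of k Tp k M] depth [of k Tm "j k" "m k"] k num by simp_all
    then show ?thesis by simp
  qed
  ultimately show ?thesis by blast
qed

lemma three_colorable_F_eq: "three_colorable_F = slope4_F"
proof
  show "three_colorable_F \<subseteq> slope4_F"
  proof
    fix g assume "g \<in> three_colorable_F"
    then obtain Tp Tm where g: "g \<in> extensional {0..1}" "represents Tp Tm g"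
      "three_colorable (Gamma_verts Tp Tm) (Gamma_edges Tp Tm)"
      by (auto simp: three_colorable_F_def thompson_F_def)
    then have "\<forall>k<num_leaves Tp. even (leaf_depths Tp ! k + leaf_depths Tm ! k)"
      using three_colorable_Gamma_iff by (auto simp: represents_def)
    then show "g \<in> slope4_F"
      unfolding slope4_F_def using g represents_ends represents_std_map by blast
  qed
  show "slope4_F \<subseteq> three_colorable_F"
  proof
    fix g assume g: "g \<in> slope4_F"
    obtain Tp Tm where "represents Tp Tm g" "\<forall>k<num_leaves Tp. even (leaf_depths Tp ! k + leaf_depths Tm ! k)"
      using slope4_F_represents [OF g] by blast
    moreover from this have "three_colorable (Gamma_verts Tp Tm) (Gamma_edges Tp Tm)"
      using three_colorable_Gamma_iff by (auto simp: represents_def)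
    ultimately show "g \<in> three_colorable_F"
      using g slope4_F_subset_thompson_F unfolding three_colorable_F_def by blast
  qed
qed

section \<open>The half line as the unit interval without its right end\<close>

text \<open>Maps the intervals \<open>[i, i + 1]\<close> to the intervals of the infinite right comb of 4-carets:
  \<open>[1 - 1 / 4 ^ q, 1 - 1 / 4 ^ (q + 1)]\<close> is cut into three equal parts.\<close>

definition comb :: "real \<Rightarrow> real" where
  "comb t = (let q = nat \<lfloor>t / 3\<rfloor> in 1 - (1 - (t - 3 * real q) / 4) / 4 ^ q)"

text \<open>At the right end \<open>3 * real q + 3\<close> the floor already selects
  \<open>Suc q\<close>, but the two formulas agree there. Closed cells are what the arguments about
  pieces need.\<close>

lemma comb_eq:
  assumes "3 * real q \<le> t" "t \<le> 3 * real q + 3"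
  shows "comb t = 1 - (1 - (t - 3 * real q) / 4) / 4 ^ q"
proof (cases "t = 3 * real q + 3")
  case True
  then have "\<lfloor>t / 3\<rfloor> = int (Suc q)"
    by (simp add: floor_eq_iff)
  then have "nat \<lfloor>t / 3\<rfloor> = Suc q"
    by simp
  then show ?thesis
    unfolding comb_def Let_def by (simp add: True)
next
  case False
  then have "\<lfloor>t / 3\<rfloor> = int q"
    using assms by (simp add: floor_eq_iff)
  then have "nat \<lfloor>t / 3\<rfloor> = q"
    by simp
  then show ?thesis
    unfolding comb_def Let_def by simp
qed

lemma comb_cell:
  assumes "0 \<le> t"
  obtains q where "3 * real q \<le> t" "t < 3 * real q + 3"
proof
  show "3 * real (nat \<lfloor>t / 3\<rfloor>) \<le> t" "t < 3 * real (nat \<lfloor>t / 3\<rfloor>) + 3"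
    using assms by linarith+
qed

text \<open>Each 4-caret contributes three leaves and leaves over its last quarter, so translation
  by \<open>3 * K\<close> becomes scaling of the distance to 1 by \<open>1 / 4 ^ K\<close>. Hence a
  map that is eventually a translation by a multiple of 3 has a power of 4 as its slope near
  1.\<close>

lemma comb_shift:
  assumes "0 \<le> t"
  shows "comb (t + 3 * real K) = 1 - (1 - comb t) / 4 ^ K"
proof -
  obtain q where q: "3 * real q \<le> t" "t < 3 * real q + 3"
    using comb_cell [OF assms] .
  have "comb (t + 3 * real K) = 1 - (1 - (t + 3 * real K - 3 * real (q + K)) / 4) / 4 ^ (q + K)"
    using q by (intro comb_eq) auto
  also have "t + 3 * real K - 3 * real (q + K) = t - 3 * real q"
    by simp
  also have "1 - (1 - (t - 3 * real q) / 4) / 4 ^ (q + K) = 1 - (1 - comb t) / 4 ^ K"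
    using comb_eq [of q t] q by (simp add: power_add)
  finally show ?thesis .
qed

lemma comb_bounds:
  assumes "0 \<le> t"
  shows "0 \<le> comb t" "comb t < 1"
proof -
  obtain q where q: "3 * real q \<le> t" "t < 3 * real q + 3"
    using comb_cell [OF assms] .
  then have c: "comb t = 1 - (1 - (t - 3 * real q) / 4) / 4 ^ q"
    by (intro comb_eq) auto
  have "1 - (t - 3 * real q) / 4 \<le> 1"
    using q by simp
  also have "(1::real) \<le> 4 ^ q"
    by simp
  finally have "1 - (t - 3 * real q) / 4 \<le> 4 ^ q" .
  then show "0 \<le> comb t"
    by (simp add: c divide_le_eq)
  show "comb t < 1"
    using q by (simp add: c)
qed

lemma comb_0 [simp]: "comb 0 = 0"
  by (simp add: comb_def)

lemma comb_3: "comb (3 * real K) = 1 - 1 / 4 ^ K"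
  using comb_shift [of 0 K] by simp

text \<open>With \<open>q = i div 3\<close> and \<open>r = i mod 3\<close>, the image of
  \<open>[i, i + 1]\<close> starts at \<open>1 - 1 / 4 ^ q + r / 4 ^ Suc q\<close>; this is its left
  end in units of \<open>1 / 4 ^ Suc q\<close>.\<close>

definition comb_index :: "nat \<Rightarrow> nat" where
  "comb_index i = 4 ^ Suc (i div 3) - 4 + i mod 3"

lemma std_map_comb: "std_map comb i 0 (comb_index i) (Suc (i div 3))"
  unfolding std_map_def
proof
  fix s :: real assume s: "s \<in> {0..1}"
  define q r where "q = i div 3" and "r = i mod 3"
  have "i = 3 * q + r"
    by (simp add: q_def r_def)
  then have i: "real i = 3 * real q + real r"
    by (metis of_nat_add of_nat_mult of_nat_numeral)
  have r: "r \<le> 2"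
    unfolding r_def by linarith
  have "comb (real i + s) = 1 - (1 - (real i + s - 3 * real q) / 4) / 4 ^ q"
    using s r by (intro comb_eq) (auto simp: i)
  also have "\<dots> = (4 ^ Suc q - 4 + real r + s) / 4 ^ Suc q"
    by (simp add: i field_simps)
  also have "(4::real) ^ Suc q - 4 = real (4 ^ Suc q - 4)"
    by (simp add: of_nat_diff)
  finally show "comb ((real i + s) / 4 ^ 0) = (real (comb_index i) + s) / 4 ^ Suc (i div 3)"
    by (simp only: comb_index_def q_def r_def of_nat_add power_0 div_by_1)
qed

lemma std_map_comb_refine: "\<exists>j. std_map comb i m j (Suc (i div 4 ^ m div 3) + m)"
  using std_map_refine [of comb i m 0] std_map_comb by fastforce

lemma comb_strict_mono: "strict_mono_on {0..} comb"
proof (rule strict_mono_onI)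
  fix x y :: real assume xy: "x \<in> {0..}" "y \<in> {0..}" "x < y"
  define n where "n = nat \<lceil>y\<rceil>"
  have "strict_mono_on {0..real n / 1} comb"
    using std_map_strict_mono_on [OF std_map_comb] by (intro piecewise_strict_mono) auto
  moreover have "y \<le> real n"
    unfolding n_def by linarith
  ultimately show "comb x < comb y"
    using xy by (intro strict_mono_onD [of "{0..real n / 1}" comb]) auto
qed

lemma comb_surj:
  assumes "0 \<le> y" "y < 1"
  shows "\<exists>t\<ge>0. comb t = y"
proof -
  obtain n where "(1 / 4) ^ n < 1 - y"
    using real_arch_pow_inv [of "1 - y" "1 / 4"] assms by auto
  \<comment> \<open>The least exponent is \<open>Suc q\<close> for the caret \<open>q\<close> of the
    comb that contains \<open>y\<close>; \<open>t\<close> below solves the affine formula of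
    \<open>comb\<close> on that caret.\<close>
  then have n: "(1 / 4) ^ (LEAST n. (1 / 4) ^ n < 1 - y) < 1 - y"
    by (rule LeastI)
  have "(LEAST n. (1 / 4) ^ n < 1 - y) \<noteq> 0"
    using n assms by (intro notI) simp
  then obtain q where q: "(LEAST n. (1 / 4) ^ n < 1 - y) = Suc q"
    using not0_implies_Suc by blast
  then have "\<not> (1 / 4) ^ q < 1 - y"
    using not_less_Least [of q "\<lambda>n. (1 / 4) ^ n < 1 - y"] by simp
  then have q1: "(1 - y) * 4 ^ q \<le> 1"
    by (simp add: power_one_over field_simps)
  have q2: "1 < (1 - y) * 4 ^ q * 4"
    using n unfolding q by (simp add: power_one_over field_simps)
  define t where "t = 3 * real q + 4 * (1 - (1 - y) * 4 ^ q)"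
  have "comb t = 1 - (1 - (t - 3 * real q) / 4) / 4 ^ q"
    using q1 q2 by (intro comb_eq) (auto simp: t_def)
  also have "(t - 3 * real q) / 4 = 1 - (1 - y) * 4 ^ q"
    by (simp add: t_def)
  also have "1 - (1 - (1 - (1 - y) * 4 ^ q)) / 4 ^ q = y"
    by simp
  finally show ?thesis
    using q1 by (intro exI [of _ t]) (auto simp: t_def)
qed

definition comb_inv :: "real \<Rightarrow> real" where
  "comb_inv = the_inv_into {0..} comb"

lemma comb_inj: "inj_on comb {0..}"
  using comb_strict_mono by (rule strict_mono_on_imp_inj_on)

lemma comb_inv_comb [simp]: "0 \<le> t \<Longrightarrow> comb_inv (comb t) = t"
  unfolding comb_inv_def by (rule the_inv_into_f_f [OF comb_inj]) simp

lemma comb_comb_inv [simp]: "0 \<le> y \<Longrightarrow> y < 1 \<Longrightarrow> comb (comb_inv y) = y"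
  using comb_surj [of y] by auto

lemma comb_inv_nonneg [simp]: "0 \<le> y \<Longrightarrow> y < 1 \<Longrightarrow> 0 \<le> comb_inv y"
  using comb_surj [of y] by auto

lemma comb_inv_0 [simp]: "comb_inv 0 = 0"
  using comb_inv_comb [of 0] by simp

lemma comb_less_iff: "0 \<le> s \<Longrightarrow> 0 \<le> t \<Longrightarrow> comb s < comb t \<longleftrightarrow> s < t"
  using strict_mono_on_less [OF comb_strict_mono] by simp

lemma comb_inv_less:
  assumes "0 \<le> y" "y < 1 - 1 / 4 ^ K"
  shows "comb_inv y < 3 * real K"
proof -
  have "y < 1"
    using assms(2) by (rule order_less_trans) simp
  then have "comb (comb_inv y) < comb (3 * real K)"
    using assms by (simp add: comb_3)
  then show ?thesis
    by (subst (asm) comb_less_iff) (use assms \<open>y < 1\<close> in auto)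
qed

lemma comb_inv_ge:
  assumes "1 - 1 / 4 ^ K \<le> y" "y < 1"
  shows "3 * real K \<le> comb_inv y"
proof -
  have "(1::real) / 4 ^ K \<le> 1"
    by simp
  then have "0 \<le> y"
    using assms by linarith
  then have "\<not> comb (comb_inv y) < comb (3 * real K)"
    using assms by (simp add: comb_3)
  then show ?thesis
    by (subst (asm) comb_less_iff) (use assms \<open>0 \<le> y\<close> in auto)
qed

text \<open>To the left of \<open>1 - 1 / 4 ^ K\<close> the leaves of the comb have level at most
  \<open>K\<close>. An interval of level \<open>M\<close> at least \<open>K\<close> therefore lies
  inside one leaf, found from its left end, and \<open>comb_inv\<close> stretches it by
  \<open>4 ^ Suc q\<close>.\<close>

lemma std_map_comb_inv:
  assumes "(real i + 1) / 4 ^ M \<le> 1 - 1 / 4 ^ K" "K \<le> M"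
  shows "\<exists>j. \<exists>q<K. std_map comb_inv i M j (M - Suc q)"
proof -
  define y where "y = real i / 4 ^ M"
  have "y < (real i + 1) / 4 ^ M"
    by (simp add: y_def divide_strict_right_mono)
  then have y: "0 \<le> y" "y < 1 - 1 / 4 ^ K"
    using assms(1) by (auto simp: y_def)
  have "y < 1"
    using y(2) by (rule order_less_trans) simp
  define b where "b = nat \<lfloor>comb_inv y\<rfloor>"
  have b: "real b \<le> comb_inv y" "comb_inv y < real b + 1"
    using comb_inv_nonneg [OF y(1) \<open>y < 1\<close>] unfolding b_def by linarith+
  have "real b < real (3 * K)"
    using b(1) comb_inv_less [OF y] by simp
  then have "b < 3 * K"
    by (simp only: of_nat_less_iff)
  define q where "q = b div 3"
  have "q < K"
    using \<open>b < 3 * K\<close> unfolding q_def by (simp add: div_less_iff_less_mult mult.commute)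
  define L where "L = M - Suc q"
  have M: "M = Suc q + L"
    using \<open>q < K\<close> assms(2) by (simp add: L_def)
  have "y = (real (comb_index b) + (comb_inv y - real b)) / 4 ^ Suc q"
    using std_mapD_point [OF std_map_comb [of b], of "comb_inv y"] b y(1) \<open>y < 1\<close>
    by (simp add: q_def)
  then have "y * 4 ^ Suc q = real (comb_index b) + (comb_inv y - real b)"
    by (simp add: field_simps)
  moreover have "y * 4 ^ Suc q = real i / 4 ^ L"
    unfolding y_def M power_add by simp
  ultimately have "real (comb_index b) \<le> real i / 4 ^ L" "real i / 4 ^ L < real (comb_index b) + 1"
    using b by linarith+
  then have "real (comb_index b * 4 ^ L) \<le> real i" "real i < real ((comb_index b + 1) * 4 ^ L)"
    by (simp_all add: field_simps)
  then have "comb_index b * 4 ^ L \<le> i" "i < (comb_index b + 1) * 4 ^ L"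
    by (simp_all only: of_nat_le_iff of_nat_less_iff)
  then have "i div 4 ^ L = comb_index b"
    by (intro div_nat_eqI) (auto simp: mult.commute)
  then have i: "comb_index b * 4 ^ L + i mod 4 ^ L = i"
    using div_mult_mod_eq [of i "4 ^ L"] by simp
  have comb: "std_map comb (b * 4 ^ L + i mod 4 ^ L) L i M"
    using std_map_subdivide [OF std_map_comb [of b], of "i mod 4 ^ L" L]
    unfolding i q_def [symmetric] M [symmetric] by simp
  have "std_map comb_inv i M (b * 4 ^ L + i mod 4 ^ L) L"
    unfolding std_map_def
  proof
    fix s :: real assume s: "s \<in> {0..1}"
    then show "comb_inv ((real i + s) / 4 ^ M) = (real (b * 4 ^ L + i mod 4 ^ L) + s) / 4 ^ L"
      using std_mapD [OF comb, of s, symmetric] by simp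
  qed
  then show ?thesis
    using \<open>q < K\<close> unfolding L_def by blast
qed

section \<open>Conjugation from the half line to the unit interval\<close>

definition unit_conj :: "(real \<Rightarrow> real) \<Rightarrow> real \<Rightarrow> real" where
  "unit_conj h = (\<lambda>y\<in>{0..1}. if y = 1 then 1 else comb (h (comb_inv y)))"

lemma unit_conj_apply: "0 \<le> y \<Longrightarrow> y < 1 \<Longrightarrow> unit_conj h y = comb (h (comb_inv y))"
  by (simp add: unit_conj_def)

lemma unit_conj_1 [simp]: "unit_conj h 1 = 1"
  by (simp add: unit_conj_def)

lemma unit_conj_compose:
  assumes "\<And>t. 0 \<le> t \<Longrightarrow> 0 \<le> h t"
  shows "compose {0..1} (unit_conj f) (unit_conj h) = unit_conj (\<lambda>t. f (h t))"
proof
  fix y :: real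
  consider "y \<notin> {0..1}" | "y = 1" | "0 \<le> y" "y < 1"
    by fastforce
  then show "compose {0..1} (unit_conj f) (unit_conj h) y = unit_conj (\<lambda>t. f (h t)) y"
  proof cases
    case 3
    then have "0 \<le> h (comb_inv y)"
      using assms by simp
    then show ?thesis
      using 3 comb_bounds [of "h (comb_inv y)"] by (simp add: compose_def unit_conj_apply)
  qed (auto simp: compose_def unit_conj_def)
qed

text \<open>Left of \<open>1 - 1 / 4 ^ K\<close> the three maps \<open>comb_inv\<close>,
  \<open>h\<close> and \<open>comb\<close> preserve standard pieces in turn. Right of it, the
  translation \<open>tail\<close> becomes scaling of the distance to 1 by
  \<open>4 ^ K / 4 ^ K'\<close>. The condition \<open>0 < m\<close> accommodates
  \<open>expand\<close>, which does not send every unit interval to a standard one.\<close>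

lemma unit_conj_slope4_F:
  assumes "h 0 = 0" "\<And>t. 0 \<le> t \<Longrightarrow> 0 \<le> h t"
    and std: "\<And>i m. 0 < m \<Longrightarrow> \<exists>j n. std_map h i m j n"
    and tail: "\<And>t. 3 * real K \<le> t \<Longrightarrow> h t = t - 3 * real K + 3 * real K'"
  shows "unit_conj h \<in> slope4_F"
proof -
  \<comment> \<open>One level beyond \<open>K\<close>, so that the pieces \<open>comb_inv\<close>
    produces on the half line have positive level, as \<open>std\<close> requires.\<close>
  define M where "M = Suc K"
  have "\<exists>j m. std_map (unit_conj h) i M j m" if i: "i < 4 ^ M" for i
  proof (cases "(real i + 1) / 4 ^ M \<le> 1 - 1 / 4 ^ K")
    case True
    then obtain j q where q: "q < K" and j: "std_map comb_inv i M j (M - Suc q)"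
      using std_map_comb_inv [of i M K] by (auto simp: M_def)
    have "0 < M - Suc q"
      using q by (simp add: M_def)
    then obtain j' n where "std_map h j (M - Suc q) j' n"
      using std by blast
    moreover obtain j'' n' where "std_map comb j' n j'' n'"
      using std_map_comb_refine by blast
    ultimately have *: "std_map (\<lambda>y. comb (h (comb_inv y))) i M j'' n'"
      using std_map_compose [OF std_map_compose [OF j]] by blast
    have "std_map (unit_conj h) i M j'' n'"
      unfolding std_map_def
    proof
      fix s :: real assume s: "s \<in> {0..1}"
      then have "(real i + s) / 4 ^ M \<le> (real i + 1) / 4 ^ M"
        by (simp add: divide_right_mono)
      also have "\<dots> < 1"
        by (rule order_le_less_trans [OF True]) simp
      finally have "unit_conj h ((real i + s) / 4 ^ M) = comb (h (comb_inv ((real i + s) / 4 ^ M)))"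
        using s by (intro unit_conj_apply) auto
      then show "unit_conj h ((real i + s) / 4 ^ M) = (real j'' + s) / 4 ^ n'"
        using std_mapD [OF *] s by simp
    qed
    then show ?thesis by blast
  next
    case False
    have "(1 - 1 / 4 ^ K) * 4 ^ M < real i + 1"
      using False by (simp only: not_le pos_less_divide_eq zero_less_power zero_less_numeral)
    also have "(1 - 1 / 4 ^ K) * 4 ^ M = (4::real) ^ M - 4"
      by (simp add: M_def left_diff_distrib)
    finally have "real (4 ^ M) < real (i + 5)"
      by simp
    then have "4 ^ M < i + 5"
      by (simp only: of_nat_less_iff)
    then have i4: "4 ^ M - i \<le> 4"
      by simp
    have le: "4 ^ M - i \<le> 4 ^ Suc K'"
      by (rule order_trans [OF i4]) simp
    have tail': "unit_conj h y = 1 - (1 - y) * 4 ^ K / 4 ^ K'" if "1 - 1 / 4 ^ K \<le> y" "y \<le> 1" for y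
    proof (cases "y = 1")
      case False
      then have y: "y < 1" "0 \<le> y"
        using that order_trans [of 0 "1 - 1 / 4 ^ K" y] by auto
      define t where "t = comb_inv y - 3 * real K"
      have t: "0 \<le> t" and y_t: "comb_inv y = t + 3 * real K"
        using comb_inv_ge that y by (auto simp: t_def)
      have "y = 1 - (1 - comb t) / 4 ^ K"
        using comb_shift [OF t, of K] y unfolding y_t [symmetric] by simp
      moreover have "unit_conj h y = 1 - (1 - comb t) / 4 ^ K'"
        using comb_shift [OF t, of K'] tail [of "comb_inv y"] t y by (simp add: unit_conj_apply y_t)
      ultimately show ?thesis
        by simp
    qed simp
    \<comment> \<open>Counting from the right end, the \<open>4 ^ M - i\<close> intervals up to 1
      correspond to as many of level \<open>Suc K'\<close>, since
      \<open>4 ^ K / (4 ^ M * 4 ^ K') = 1 / 4 ^ Suc K'\<close>.\<close>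
    have "std_map (unit_conj h) i M (4 ^ Suc K' - (4 ^ M - i)) (Suc K')"
      unfolding std_map_def
    proof
      fix s :: real assume s: "s \<in> {0..1}"
      have "real (i + 1) \<le> real (4 ^ M)" "real (4 ^ M) \<le> real (i + 4)"
        using i \<open>4 ^ M < i + 5\<close> by (simp_all only: of_nat_le_iff)
      then have "(4 ^ M - 4) / 4 ^ M \<le> (real i + s) / 4 ^ M" "(real i + s) / 4 ^ M \<le> 1"
        using s by (auto intro: divide_right_mono)
      moreover have "(4 ^ M - 4) / 4 ^ M = 1 - 1 / (4::real) ^ K"
        by (simp add: M_def field_simps)
      ultimately have "1 - 1 / 4 ^ K \<le> (real i + s) / 4 ^ M" "(real i + s) / 4 ^ M \<le> 1"
        by simp_all
      from tail' [OF this]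
      have "unit_conj h ((real i + s) / 4 ^ M) = 1 - (1 - (real i + s) / 4 ^ M) * 4 ^ K / 4 ^ K'" .
      also have "\<dots> = (4 ^ Suc K' - (4 ^ M - real i) + s) / 4 ^ Suc K'"
        by (simp add: M_def field_simps)
      finally show "unit_conj h ((real i + s) / 4 ^ M) =
          (real (4 ^ Suc K' - (4 ^ M - i)) + s) / 4 ^ Suc K'"
        using le i by (simp add: of_nat_diff del: power_Suc)
    qed
    then show ?thesis by blast
  qed
  moreover have "unit_conj h \<in> extensional {0..1}"
    by (simp add: unit_conj_def)
  moreover have "unit_conj h 0 = 0"
    using assms(1) by (simp add: unit_conj_apply)
  ultimately show ?thesis
    unfolding slope4_F_def by auto
qed

text \<open>Refining the domain of \<open>g\<close> by \<open>M\<close> further levels puts the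
  images at level \<open>m + M\<close>, so each lies inside a level \<open>M\<close> interval, where
  \<open>f\<close> is standard.\<close>

lemma slope4_F_compose:
  assumes f: "f \<in> slope4_F" and g: "g \<in> slope4_F"
  shows "compose {0..1} f g \<in> slope4_F"
proof -
  obtain M where M: "\<And>i. i < 4 ^ M \<Longrightarrow> \<exists>j m. std_map f i M j m"
    using f by (auto simp: slope4_F_def)
  obtain N where N: "\<And>i. i < 4 ^ N \<Longrightarrow> \<exists>j m. std_map g i N j m"
    using g by (auto simp: slope4_F_def)
  have "\<exists>j m. std_map (compose {0..1} f g) i (N + M) j m" if i: "i < 4 ^ (N + M)" for i
  proof -
    have "i div 4 ^ M < 4 ^ N"
      using i by (simp add: div_less_iff_less_mult power_add)
    then obtain j m where "std_map g i (N + M) j (m + M)"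
      using N std_map_refine by meson
    note j = this
    have "real (i + 1) \<le> real (4 ^ (N + M))"
      using i by (simp only: of_nat_le_iff)
    then have i1: "real i + 1 \<le> 4 ^ (N + M)"
      by simp
    then have "(real i + 1) / 4 ^ (N + M) \<in> {0..1}"
      by simp
    then have "g ((real i + 1) / 4 ^ (N + M)) \<le> 1"
      using slope4_F_image [OF g] by (metis atLeastAtMost_iff image_eqI)
    then have "real (j + 1) \<le> real (4 ^ (m + M))"
      using std_mapD [OF j, of 1] by (simp add: divide_le_eq)
    then have "j < 4 ^ (M + m)"
      unfolding of_nat_le_iff by (simp add: add.commute)
    then have "j div 4 ^ m < 4 ^ M"
      by (simp add: div_less_iff_less_mult power_add)
    then obtain k n where "std_map f j (M + m) k n"
      using M std_map_refine by meson
    then have "std_map f j (m + M) k n"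
      by (simp add: add.commute)
    from std_map_compose [OF j this] have *: "std_map (\<lambda>t. f (g t)) i (N + M) k n" .
    have "std_map (compose {0..1} f g) i (N + M) k n"
      unfolding std_map_def
    proof
      fix s :: real assume s: "s \<in> {0..1}"
      then have "(real i + s) / 4 ^ (N + M) \<in> {0..1}"
        using i1 by auto
      then show "compose {0..1} f g ((real i + s) / 4 ^ (N + M)) = (real k + s) / 4 ^ n"
        using std_mapD [OF *] s by (simp add: compose_def)
    qed
    then show ?thesis by blast
  qed
  moreover have "compose {0..1} f g 0 = 0" "compose {0..1} f g 1 = 1"
    using f g by (auto simp: compose_def slope4_F_def)
  ultimately show ?thesis
    unfolding slope4_F_def by (auto simp: compose_extensional)
qed

lemma unit_conj_contract: "unit_conj (contract (real k)) \<in> slope4_F"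
proof (rule unit_conj_slope4_F)
  \<comment> \<open>A multiple of 3 beyond \<open>k + 4\<close>, where the contraction has become
    translation by -3.\<close>
  fix t assume "3 * real (k + 4) \<le> t"
  then show "contract (real k) t = t - 3 * real (k + 4) + 3 * real (k + 3)"
    by (simp add: contract_eqs)
next
  show "\<exists>j n. std_map (contract (real k)) i m j n" for i m
    by (rule std_map_contract)
qed (simp_all add: contract_eqs contract_nonneg)

lemma unit_conj_expand: "unit_conj (expand (real k)) \<in> slope4_F"
proof (rule unit_conj_slope4_F)
  fix t assume "3 * real (k + 1) \<le> t"
  then show "expand (real k) t = t - 3 * real (k + 1) + 3 * real (k + 2)"
    by (simp add: expand_eqs)
next
  show "\<exists>j n. std_map (expand (real k)) i m j n" if "0 < m" for i m
    using std_map_expand that by blast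
qed (simp_all add: expand_eqs expand_nonneg)

lemma unit_conj_id: "unit_conj (\<lambda>t. t) = (\<lambda>y\<in>{0..1}. y)"
  by (rule ext) (auto simp: unit_conj_def)

lemma id_slope4_F: "(\<lambda>y\<in>{0..1}. y) \<in> slope4_F"
proof -
  have "std_map (\<lambda>y\<in>{0..1}. y) 0 0 0 0"
    by (auto simp: std_map_def)
  then have "\<forall>i<4 ^ 0. \<exists>j m. std_map (\<lambda>y\<in>{0..1}. y) i 0 j m"
    by auto
  then have "\<exists>M. \<forall>i<4 ^ M. \<exists>j m. std_map (\<lambda>y\<in>{0..1}. y) i M j m"
    by blast
  then show ?thesis
    by (simp add: slope4_F_def)
qed

lemma unit_conj_act:
  assumes "w \<in> F4_words"
  shows "unit_conj (act w) \<in> slope4_F"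
  using assms
proof (induction w)
  case Nil
  have "act [] = (\<lambda>t. t)"
    by (rule ext) simp
  then show ?case
    by (simp only: unit_conj_id id_slope4_F)
next
  case (Cons l w)
  obtain k e where l: "l = (k, e)" "1 \<le> k"
    using Cons.hyps by auto
  have "unit_conj ((if e then contract else expand) (real (k - 1))) \<in> slope4_F"
    using unit_conj_contract unit_conj_expand by (cases e) (simp_all only: if_True if_False)
  then have "compose {0..1} (unit_conj ((if e then contract else expand) (real (k - 1)))) (unit_conj (act w)) \<in> slope4_F"
    using Cons.IH by (rule slope4_F_compose)
  moreover have "act (l # w) = (\<lambda>t. (if e then contract else expand) (real (k - 1)) (act w t))"
    using l by (intro ext) (simp add: of_nat_diff)
  ultimately show ?case
    using Cons.hyps by (simp only: unit_conj_compose act_nonneg)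
qed

lemma unit_conj_act_append:
  assumes "v \<in> F4_words"
  shows "unit_conj (act (u @ v)) = compose {0..1} (unit_conj (act u)) (unit_conj (act v))"
proof -
  have "act (u @ v) = (\<lambda>t. act u (act v t))"
    by (rule ext) (rule act_append)
  then show ?thesis
    using assms by (simp only: unit_conj_compose act_nonneg)
qed

lemma unit_conj_act_faithful:
  assumes "u \<in> F4_words" "v \<in> F4_words" "unit_conj (act u) = unit_conj (act v)"
  shows "u \<simeq>\<^sub>4 v"
proof (rule act_faithful [OF assms(1,2)])
  fix t :: real assume t: "0 \<le> t"
  have "comb (act u t) = comb (act v t)"
    using fun_cong [OF assms(3), of "comb t"] t comb_bounds [OF t] by (simp add: unit_conj_apply)
  then show "act u t = act v t"
    using inj_onD [OF comb_inj] act_nonneg assms t by simp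
qed

section \<open>Every map with slopes powers of 4 comes from a word\<close>

text \<open>Let \<open>h\<close> be \<open>g\<close> seen on the half line. Both the contraction
  \<open>p\<close> and \<open>h\<close> after \<open>p\<close> send unit intervals to standard
  intervals and are translations far out, so they are positive words \<open>v\<close> and
  \<open>u\<close>, and \<open>h\<close> is \<open>u\<close> times the inverse of
  \<open>v\<close>.\<close>

lemma slope4_F_act_surj:
  assumes g: "g \<in> slope4_F"
  shows "\<exists>w\<in>F4_words. unit_conj (act w) = g"
proof -
  obtain K where K: "\<And>i. i < 4 ^ K \<Longrightarrow> \<exists>j m. std_map g i K j m"
    using g by (auto simp: slope4_F_def)
  have g01: "g 0 = 0" "g 1 = 1"
    using g by (auto simp: slope4_F_def)
  have g_inj: "inj_on g {0..1}"
    using slope4_F_strict_mono [OF g] by (rule strict_mono_on_imp_inj_on)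
  have g_mono: "g x \<le> g y" if "0 \<le> x" "x \<le> y" "y \<le> 1" for x y
    using strict_mono_on_leD [OF slope4_F_strict_mono [OF g]] that by simp
  have g_range: "0 \<le> g y" "g y < 1" if "0 \<le> y" "y < 1" for y
  proof -
    show "0 \<le> g y"
      using g_mono [of 0 y] g01 that by simp
    have "g y < g 1"
      using that by (intro strict_mono_onD [OF slope4_F_strict_mono [OF g]]) auto
    then show "g y < 1"
      by (simp add: g01)
  qed
  \<comment> \<open>The last piece ends at the fixed point 1, so its image is the last interval of
    level \<open>K'\<close>; this gives the scaling of \<open>g\<close> near 1.\<close>
  obtain j K' where "std_map g (4 ^ K - 1) K j K'"
    using K [of "4 ^ K - 1"] by auto
  note last = this
  have "real (4 ^ K - 1) = 4 ^ K - 1"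
    by (simp add: of_nat_diff)
  then have j: "real j + 1 = 4 ^ K'"
    using std_mapD [OF last, of 1] g01 by (simp add: divide_eq_eq)
  have g_end: "g y = 1 - (1 - y) * 4 ^ K / 4 ^ K'" if "1 - 1 / 4 ^ K \<le> y" "y \<le> 1" for y
  proof -
    have "4 ^ K - 1 \<le> y * 4 ^ K" "y * 4 ^ K \<le> 4 ^ K"
      using that by (simp_all add: field_simps)
    then have "g y = (real j + (y * 4 ^ K - (4 ^ K - 1))) / 4 ^ K'"
      using std_mapD_point [OF last, of y] unfolding \<open>real (4 ^ K - 1) = 4 ^ K - 1\<close> by simp
    also have "real j = 4 ^ K' - 1"
      using j by simp
    finally show ?thesis
      by (simp add: field_simps)
  qed
  define h where "h t = comb_inv (g (comb t))" for t
  have comb_h: "comb (h t) = g (comb t)" if "0 \<le> t" for t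
    using comb_bounds [OF that] g_range [of "comb t"] by (simp add: h_def)
  have h_inj: "inj_on h {0..}"
  proof (rule inj_onI)
    fix s t :: real assume st: "s \<in> {0..}" "t \<in> {0..}" "h s = h t"
    then have "g (comb s) = g (comb t)"
      using comb_h [of s] comb_h [of t] by simp
    then have "comb s = comb t"
      by (rule inj_onD [OF g_inj]) (use st comb_bounds [of s] comb_bounds [of t] in auto)
    then show "s = t"
      by (rule inj_onD [OF comb_inj]) (use st in auto)
  qed
  have h_tail: "h (t + 3 * real K) = t + 3 * real K'" if "0 \<le> t" for t
  proof -
    have "g (comb (t + 3 * real K)) = 1 - (1 - comb (t + 3 * real K)) * 4 ^ K / 4 ^ K'"
      using comb_shift [OF that, of K] comb_bounds [OF that] by (intro g_end) (auto simp: divide_right_mono)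
    also have "\<dots> = comb (t + 3 * real K')"
      by (simp add: comb_shift [OF that])
    finally show ?thesis
      using that by (simp add: h_def)
  qed
  \<comment> \<open>\<open>N\<close> counts the level \<open>L\<close> intervals in
    \<open>[0, 3 * K]\<close>. The choice of \<open>L\<close> makes their images under
    \<open>comb\<close> lie in level \<open>K\<close> pieces of \<open>g\<close>, and gives the
    images under \<open>g\<close> level at least \<open>K'\<close>, as needed for inverting
    \<open>comb\<close>.\<close>
  define L N where "L = K + K'" and "N = 3 * K * 4 ^ L"
  have h_std: "\<exists>j m. std_map h i L j m" if "i < N" for i
  proof -
    obtain i' q where i': "std_map comb i L i' (q + L)"
      using std_map_comb_refine by blast
    define D where "D = q + L - K"
    have D: "q + L = K + D" "K' \<le> D"
      by (auto simp: D_def L_def)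
    have "real (i + 1) \<le> real (3 * K * 4 ^ L)"
      using that unfolding N_def of_nat_le_iff by simp
    then have "(real i + 1) / 4 ^ L \<le> 3 * real K"
      by (simp add: pos_divide_le_eq)
    then have "comb ((real i + 1) / 4 ^ L) \<le> comb (3 * real K)"
      by (intro strict_mono_on_leD [OF comb_strict_mono]) auto
    then have le: "(real i' + 1) / 4 ^ (q + L) \<le> 1 - 1 / 4 ^ K"
      using std_mapD [OF i', of 1] by (simp add: comb_3)
    have "(real i' + 1) / 4 ^ (q + L) \<le> 1"
      by (rule order_trans [OF le]) simp
    then have "real (i' + 1) \<le> real (4 ^ (q + L))"
      by (simp add: divide_le_eq)
    then have "i' < 4 ^ K * 4 ^ D"
      unfolding of_nat_le_iff by (simp add: D power_add)
    then have "i' div 4 ^ D < 4 ^ K"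
      by (simp add: div_less_iff_less_mult)
    then obtain j' m where "std_map g i' (K + D) j' (m + D)"
      using K std_map_refine by meson
    then have j': "std_map g i' (q + L) j' (m + D)"
      by (simp add: D)
    have "(real j' + 1) / 4 ^ (m + D) = g ((real i' + 1) / 4 ^ (q + L))"
      using std_mapD [OF j', of 1] by simp
    also have "\<dots> \<le> g (1 - 1 / 4 ^ K)"
      using le by (intro g_mono) auto
    also have "\<dots> = 1 - 1 / 4 ^ K'"
      using g_end [of "1 - 1 / 4 ^ K"] by simp
    finally obtain k n where "std_map comb_inv j' (m + D) k n"
      using std_map_comb_inv [of j' "m + D" K'] D by auto
    from std_map_compose [OF std_map_compose [OF i' j'] this]
    show ?thesis
      unfolding h_def by blast
  qed
  \<comment> \<open>Up to \<open>N\<close> a unit interval becomes a level \<open>L\<close>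
    interval, on which \<open>h\<close> is standard; beyond \<open>N\<close>, \<open>p\<close> is
    the translation that continues this.\<close>
  define p where "p t = (if t \<le> real N then t / 4 ^ L else t - real N + 3 * real K)" for t
  have N: "real N = 3 * real K * 4 ^ L"
    by (simp add: N_def)
  have p_low: "p t = t / 4 ^ L" if "t \<le> real N" for t
    using that by (simp add: p_def)
  have p_high: "p t = t - real N + 3 * real K" if "real N \<le> t" for t
    using that by (auto simp: p_def N)
  have p_nonneg: "0 \<le> p t" if "0 \<le> t" for t
    using that by (simp add: p_def)
  have p_mono: "strict_mono p"
  proof (rule strict_monoI)
    fix s t :: real assume st: "s < t"
    consider "t \<le> real N" | "real N \<le> s" | "s < real N" "real N < t"
      by linarith
    then show "p s < p t"
    proof cases
      case 3
      then have "s / 4 ^ L < 3 * real K"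
        by (simp add: N pos_divide_less_eq)
      then show ?thesis
        using 3 by (simp add: p_def)
    qed (use st in \<open>simp_all add: p_low p_high divide_strict_right_mono\<close>)
  qed
  have p_std: "std_map p i 0 (if i < N then i else i - N + 3 * K) (if i < N then L else 0)" for i
    unfolding std_map_def
  proof
    fix s :: real assume s: "s \<in> {0..1}"
    show "p ((real i + s) / 4 ^ 0) =
        (real (if i < N then i else i - N + 3 * K) + s) / 4 ^ (if i < N then L else 0)"
    proof (cases "i < N")
      case True
      then have "real i + 1 \<le> real N"
        by linarith
      then show ?thesis
        using True s by (simp add: p_low)
    next
      case False
      then show ?thesis
        using s by (simp add: p_high of_nat_diff)
    qed
  qed
  have "\<exists>v. set v \<subseteq> {1..} \<and> (\<forall>t\<ge>0. p t = act (positive_word v) t)"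
  proof (rule std_pieces_imp_positive_word [OF _ _ p_std, of N])
    show "inj_on p {0..}"
      by (rule strict_mono_imp_inj_on [OF p_mono])
  qed (simp_all add: p_low)
  then obtain v where v: "set v \<subseteq> {1..}" "\<And>t. 0 \<le> t \<Longrightarrow> p t = act (positive_word v) t"
    by blast
  have hp_std: "\<exists>j m. std_map (\<lambda>t. h (p t)) i 0 j m \<and> (N \<le> i \<longrightarrow> m = 0)" for i
  proof (cases "i < N")
    case True
    then obtain j m where hi: "std_map h i L j m"
      using h_std by blast
    have "std_map p i 0 i L"
      using p_std [of i] True by simp
    from std_map_compose [OF this hi] show ?thesis
      using True by (meson not_le)
  next
    case False
    have hi: "std_map h (i - N + 3 * K) 0 (i - N + 3 * K') 0"
      unfolding std_map_def
    proof
      fix s :: real assume "s \<in> {0..1}"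
      then show "h ((real (i - N + 3 * K) + s) / 4 ^ 0) = (real (i - N + 3 * K') + s) / 4 ^ 0"
        using h_tail [of "real (i - N) + s"] by (simp add: algebra_simps)
    qed
    have "std_map p i 0 (i - N + 3 * K) 0"
      using p_std [of i] False by simp
    from std_map_compose [OF this hi] show ?thesis
      by blast
  qed
  have "\<exists>u. set u \<subseteq> {1..} \<and> (\<forall>t\<ge>0. h (p t) = act (positive_word u) t)"
  proof -
    obtain j m where jm: "\<And>i. std_map (\<lambda>t. h (p t)) i 0 (j i) (m i)" "\<And>i. N \<le> i \<Longrightarrow> m i = 0"
      using hp_std by metis
    have "h (p 0) = 0"
      by (simp add: p_low h_def g01)
    moreover have "inj_on (\<lambda>t. h (p t)) {0..}"
    proof (rule inj_onI)
      fix s t :: real assume st: "s \<in> {0..}" "t \<in> {0..}" "h (p s) = h (p t)"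
      have "p s = p t"
        by (rule inj_onD [OF h_inj st(3)]) (use st p_nonneg in auto)
      then show "s = t"
        using strict_mono_eq [OF p_mono] by simp
    qed
    ultimately show ?thesis
      using jm by (rule std_pieces_imp_positive_word)
  qed
  then obtain u where u: "set u \<subseteq> {1..}" "\<And>t. 0 \<le> t \<Longrightarrow> h (p t) = act (positive_word u) t"
    by blast
  define w where "w = positive_word u @ formal_inverse (positive_word v)"
  have w: "w \<in> F4_words"
    using u v by (simp add: w_def)
  have act_w: "act w t = h t" if "0 \<le> t" for t
  proof -
    \<comment> \<open>The point that \<open>p\<close> sends to \<open>t\<close>.\<close>
    define t' where "t' = act (formal_inverse (positive_word v)) t"
    have "0 \<le> t'"
      unfolding t'_def using v that by (intro act_nonneg) auto
    then have "act w t = h (p t')"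
      by (simp add: w_def act_append u(2) t'_def)
    also have "p t' = t"
      using v(2) [OF \<open>0 \<le> t'\<close>] by (simp add: t'_def)
    finally show ?thesis .
  qed
  have "unit_conj (act w) = g"
  proof
    fix y :: real
    consider "y \<notin> {0..1}" | "y = 1" | "0 \<le> y" "y < 1"
      by fastforce
    then show "unit_conj (act w) y = g y"
    proof cases
      case 1
      then show ?thesis
        using g by (auto simp: unit_conj_def slope4_F_def extensional_def)
    next
      case 3
      then show ?thesis
        using comb_h [of "comb_inv y"] by (simp add: unit_conj_apply act_w)
    qed (simp add: g01)
  qed
  then show ?thesis
    using w by blast
qed

section \<open>The isomorphism and the subgroup property\<close>

definition F4_to_F :: "nat word set \<Rightarrow> real \<Rightarrow> real" where
  "F4_to_F A = unit_conj (act (SOME w. w \<in> A))"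

abbreviation F4_class :: "nat word \<Rightarrow> nat word set" where
  "F4_class w \<equiv> pres_cong {1..} F4_rels `` {w}"

lemma carrier_F4: "carrier F4 = F4_class ` F4_words"
  by (auto simp: F4_def presented_group_def quotient_def)

lemma F4_to_F_class:
  assumes "w \<in> F4_words"
  shows "F4_to_F (F4_class w) = unit_conj (act w)"
proof -
  have "w \<in> F4_class w"
    using assms by (simp add: pres_cong.refl)
  then have "(SOME w'. w' \<in> F4_class w) \<in> F4_class w"
    by (rule someI)
  then have "act (SOME w'. w' \<in> F4_class w) = act w"
    using act_cong by (intro ext) auto
  then show ?thesis
    by (simp add: F4_to_F_def)
qed

lemma F4_mult_class:
  "u \<in> F4_words \<Longrightarrow> v \<in> F4_words \<Longrightarrow> F4_class u \<otimes>\<^bsub>F4\<^esub> F4_class v = F4_class (u @ v)"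
  unfolding F4_def by (rule presented_group_mult)

lemma thompson_group_mult:
  "f \<in> slope4_F \<Longrightarrow> g \<in> slope4_F \<Longrightarrow> f \<otimes>\<^bsub>thompson_group\<^esub> g = compose {0..1} f g"
  using slope4_F_bij by (simp add: thompson_group_def BijGroup_def)

lemma thompson_group_one: "\<one>\<^bsub>thompson_group\<^esub> = (\<lambda>y\<in>{0..1}. y)"
  by (simp add: thompson_group_def BijGroup_def)

lemma F4_iso_slope4_F: "F4_to_F \<in> iso F4 (thompson_group\<lparr>carrier := slope4_F\<rparr>)"
proof (rule isoI)
  show "F4_to_F \<in> hom F4 (thompson_group\<lparr>carrier := slope4_F\<rparr>)"
  proof (rule homI)
    fix A assume "A \<in> carrier F4"
    then obtain u where u: "u \<in> F4_words" "A = F4_class u"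
      by (auto simp: carrier_F4)
    then have "F4_to_F A \<in> slope4_F"
      by (simp only: F4_to_F_class unit_conj_act)
    then show "F4_to_F A \<in> carrier (thompson_group\<lparr>carrier := slope4_F\<rparr>)"
      by simp
    fix B assume "B \<in> carrier F4"
    then obtain v where v: "v \<in> F4_words" "B = F4_class v"
      by (auto simp: carrier_F4)
    have "F4_to_F (A \<otimes>\<^bsub>F4\<^esub> B) = unit_conj (act (u @ v))"
      unfolding u v F4_mult_class [OF u(1) v(1)] using u v by (intro F4_to_F_class) auto
    also have "\<dots> = compose {0..1} (F4_to_F A) (F4_to_F B)"
      using unit_conj_act_append [OF v(1)] F4_to_F_class [OF u(1)] F4_to_F_class [OF v(1)] u v by simp
    also have "\<dots> = F4_to_F A \<otimes>\<^bsub>thompson_group\<^esub> F4_to_F B"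
      using F4_to_F_class [OF u(1)] F4_to_F_class [OF v(1)] unit_conj_act u v
      by (simp add: thompson_group_mult)
    finally show "F4_to_F (A \<otimes>\<^bsub>F4\<^esub> B) = F4_to_F A \<otimes>\<^bsub>thompson_group\<lparr>carrier := slope4_F\<rparr>\<^esub> F4_to_F B"
      by simp
  qed
  have "inj_on F4_to_F (carrier F4)"
  proof (rule inj_onI)
    fix A B assume "A \<in> carrier F4" "B \<in> carrier F4" and eq: "F4_to_F A = F4_to_F B"
    then obtain u v where uv: "u \<in> F4_words" "A = F4_class u" "v \<in> F4_words" "B = F4_class v"
      by (auto simp: carrier_F4)
    have "unit_conj (act u) = unit_conj (act v)"
      using eq unfolding uv(2,4) F4_to_F_class [OF uv(1)] F4_to_F_class [OF uv(3)] .
    then have "u \<simeq>\<^sub>4 v"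
      by (rule unit_conj_act_faithful [OF uv(1,3)])
    then show "A = B"
      unfolding uv by (rule equiv_class_eq [OF equiv_pres_cong])
  qed
  moreover have "F4_to_F ` carrier F4 = slope4_F"
  proof -
    have "F4_to_F ` carrier F4 = (\<lambda>w. unit_conj (act w)) ` F4_words"
      unfolding carrier_F4 image_image by (rule image_cong) (simp_all only: F4_to_F_class)
    also have "\<dots> = slope4_F"
      using unit_conj_act slope4_F_act_surj by blast
    finally show ?thesis .
  qed
  ultimately show "bij_betw F4_to_F (carrier F4) (carrier (thompson_group\<lparr>carrier := slope4_F\<rparr>))"
    by (simp add: bij_betw_def)
qed

text \<open>Every element comes from a word, and the formal inverse of the word acts inversely. No
  subdivision of the image has to be constructed.\<close>

lemma slope4_F_inverse:
  assumes "f \<in> slope4_F"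
  obtains g where "g \<in> slope4_F" "compose {0..1} f g = (\<lambda>y\<in>{0..1}. y)"
    "compose {0..1} g f = (\<lambda>y\<in>{0..1}. y)"
proof -
  obtain w where w: "w \<in> F4_words" "f = unit_conj (act w)"
    using slope4_F_act_surj [OF assms] by blast
  have w': "formal_inverse w \<in> F4_words"
    using w by simp
  show ?thesis
  proof (rule that)
    show "unit_conj (act (formal_inverse w)) \<in> slope4_F"
      by (rule unit_conj_act [OF w'])
    show "compose {0..1} f (unit_conj (act (formal_inverse w))) = (\<lambda>y\<in>{0..1}. y)"
      using unit_conj_compose [OF act_nonneg [OF w']] unfolding w(2)
      by (simp only: act_formal_inverse_cancel unit_conj_id)
    show "compose {0..1} (unit_conj (act (formal_inverse w))) f = (\<lambda>y\<in>{0..1}. y)"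
      using unit_conj_compose [OF act_nonneg [OF w(1)]] unfolding w(2)
      by (simp only: act_formal_inverse_cancel unit_conj_id)
  qed
qed

lemma subgroup_slope4_F: "subgroup slope4_F thompson_group"
proof
  show "slope4_F \<subseteq> carrier thompson_group"
    using slope4_F_subset_thompson_F by (simp add: thompson_group_def)
  show "\<one>\<^bsub>thompson_group\<^esub> \<in> slope4_F"
    unfolding thompson_group_one by (rule id_slope4_F)
  fix f assume f: "f \<in> slope4_F"
  show "f \<otimes>\<^bsub>thompson_group\<^esub> g \<in> slope4_F" if "g \<in> slope4_F" for g
    using slope4_F_compose [OF f that] by (simp add: thompson_group_mult f that)
  show "inv\<^bsub>thompson_group\<^esub> f \<in> slope4_F"
  proof -
    obtain g where g: "g \<in> slope4_F" "compose {0..1} f g = (\<lambda>y\<in>{0..1}. y)"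
      "compose {0..1} g f = (\<lambda>y\<in>{0..1}. y)"
      using slope4_F_inverse [OF f] .
    \<comment> \<open>The inverse is a definite description over all of \<open>thompson_F\<close>,
      so a competitor \<open>k\<close> must be shown equal to \<open>g\<close>. As a homeomorphism,
      \<open>k\<close> belongs to \<open>Bij\<close>, where the product unfolds to
      composition.\<close>
    have "inv\<^bsub>thompson_group\<^esub> f = g"
      unfolding m_inv_def
    proof (rule the_equality)
      show "g \<in> carrier thompson_group \<and> f \<otimes>\<^bsub>thompson_group\<^esub> g = \<one>\<^bsub>thompson_group\<^esub> \<and>
          g \<otimes>\<^bsub>thompson_group\<^esub> f = \<one>\<^bsub>thompson_group\<^esub>"
        using f g slope4_F_subset_thompson_F
        by (auto simp only: thompson_group_mult thompson_group_one) (auto simp: thompson_group_def)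
    next
      fix k
      assume k: "k \<in> carrier thompson_group \<and> f \<otimes>\<^bsub>thompson_group\<^esub> k = \<one>\<^bsub>thompson_group\<^esub> \<and>
        k \<otimes>\<^bsub>thompson_group\<^esub> f = \<one>\<^bsub>thompson_group\<^esub>"
      then obtain k' where k_F: "k \<in> extensional {0..1}" and hom: "homeomorphism {0..1} {0..1} k k'"
        by (auto simp: thompson_group_def thompson_F_def)
      have k01: "k ` {0..1} = {0..1}" "inj_on k {0..1}"
        using hom by (auto simp: homeomorphism_def intro: inj_on_inverseI)
      then have "k \<in> Bij {0..1}"
        using k_F by (simp add: Bij_def bij_betw_def)
      then have fk: "compose {0..1} f k = (\<lambda>y\<in>{0..1}. y)"
        using k slope4_F_bij [OF f] by (simp add: thompson_group_def BijGroup_def)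
      show "k = g"
      proof (rule extensionalityI [OF k_F])
        show "g \<in> extensional {0..1}"
          using g by (simp add: slope4_F_def)
        fix y :: real assume y: "y \<in> {0..1}"
        then have "k y \<in> {0..1}"
          using k01 by blast
        then have "k y = g (f (k y))"
          using fun_cong [OF g(3), of "k y"] by (simp add: compose_def)
        also have "f (k y) = y"
          using fun_cong [OF fk, of y] y by (simp add: compose_def)
        finally show "k y = g y" .
      qed
    qed
    then show ?thesis
      using g by simp
  qed
qed

theorem theorem1p3:
  shows "subgroup three_colorable_F thompson_group \<and>
    thompson_group\<lparr>carrier := three_colorable_F\<rparr> \<cong> F4"
proof
  show "subgroup three_colorable_F thompson_group"
    unfolding three_colorable_F_eq by (rule subgroup_slope4_F)
  have "group F4"
    unfolding F4_def by (rule group_presented_group)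
  moreover have "F4 \<cong> thompson_group\<lparr>carrier := slope4_F\<rparr>"
    using F4_iso_slope4_F by (rule is_isoI)
  ultimately show "thompson_group\<lparr>carrier := three_colorable_F\<rparr> \<cong> F4"
    unfolding three_colorable_F_eq by (rule group.iso_sym)
qed

end
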